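(* Let $T>0$ and let $f^T:\mathbb{R}\times[0,1]\to\mathbb{R}$ satisfy the standing assumptions in the context. Consider the problem of finding a real number $c$ and a function $U:\mathbb{R}\times\mathbb{R}\to[0,1]$, $(t,\xi)\mapsto U(t,\xi)$, such that $$\begin{cases} U_t-cU_\xi-U_{\xi\xi}-f^T(t,U)=0, & \forall (t,\xi)\in\mathbb{R}\times\mathbb{R},\\ U(\cdot,-\infty)=1,\quad U(\cdot,+\infty)=0, & \text{uniformly on }\mathbb{R},\\ U(t+T,\xi)=U(t,\xi), & \forall (t,\xi)\in\mathbb{R}\times\mathbb{R}.\end{cases}$$ There exists at most one couple $(c,U)$ solving this problem, the function $U$ being unique up to shifts in $\xi$ (that is, if $(c_1,U_1)$ and $(c_2,U_2)$ are two solutions, then $c_1=c_2$ and there is $\tau\in\mathbb{R}$ with $U_1(t,\xi)=U_2(t,\xi-\tau)$ for all $(t,\xi)\in\mathbb{R}^2$). Moreover, if $(c,U)$ is a solution, then $U_\xi(t,\xi)<0$ for all $t\in\mathbb{R}$ and all $\xi\in\mathbb{R}$.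
   Context: Standing assumptions on $f^T$: $f^T:\mathbb{R}\times[0,1]\to\mathbb{R}$, $(t,u)\mapsto f^T(t,u)$, is of class $\mathcal{C}^1$ with respect to $t$ uniformly for $u\in[0,1]$ and of class $\mathcal{C}^2$ with respect to $u$ uniformly for $t\in\mathbb{R}$; $f^T(t+T,u)=f^T(t,u)$ for all $t\in\mathbb{R}$, $u\in[0,1]$; $f^T(t,0)=f^T(t,1)=0$ for all $t\in\mathbb{R}$; and $$\frac1T\int_0^T f^T_u(s,0)\,ds<0,\qquad \frac1T\int_0^T f^T_u(s,1)\,ds<0,$$ where $f^T_u$ is the partial derivative with respect to $u$. Solutions $U$ are classical. *)

theory Defs
  imports "HOL-Analysis.Analysis"
begin

text \<open>
  The function \<^term>\<open>g p\<close> of a real variable is of class \<open>C\<^sup>k\<close> on \<open>S\<close> uniformly for the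
  parameter \<open>p \<in> P\<close>: the derivatives up to order \<open>k\<close> exist (one-sided at end points of \<open>S\<close>), and each
  of them is continuous on \<open>S\<close> with a modulus of continuity that does not depend on \<open>p\<close>.
  The function \<open>D j p\<close> is the derivative of order \<open>j\<close> of \<open>g p\<close>.
\<close>

definition C_k_uniformly_on ::
    "nat \<Rightarrow> real set \<Rightarrow> 'p set \<Rightarrow> ('p \<Rightarrow> real \<Rightarrow> real) \<Rightarrow> bool" where
  "C_k_uniformly_on k S P g \<longleftrightarrow>
     (\<exists>D :: nat \<Rightarrow> 'p \<Rightarrow> real \<Rightarrow> real.
        (\<forall>p\<in>P. \<forall>x\<in>S. D 0 p x = g p x) \<and>
        (\<forall>j<k. \<forall>p\<in>P. \<forall>x\<in>S. (D j p has_real_derivative D (Suc j) p x) (at x within S)) \<and>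
        (\<forall>j\<le>k. \<forall>x\<in>S. uniform_limit P (\<lambda>y p. D j p y) (\<lambda>p. D j p x) (at x within S)))"

text \<open>
  The partial derivative \<open>f\<^sub>u\<close> of a function on \<open>\<real> \<times> [0,1]\<close>; it is one-sided at
  \<open>u = 0\<close> and \<open>u = 1\<close>, and values of \<open>f t\<close> outside \<open>[0,1]\<close> play no role.
\<close>

definition partial_u :: "(real \<Rightarrow> real \<Rightarrow> real) \<Rightarrow> real \<Rightarrow> real \<Rightarrow> real" where
  "partial_u f t u = vector_derivative (f t) (at u within {0..1})"

definition partial_t :: "(real \<Rightarrow> real \<Rightarrow> real) \<Rightarrow> real \<Rightarrow> real \<Rightarrow> real" where
  "partial_t U t \<xi> = deriv (\<lambda>s. U s \<xi>) t"

definition partial_xi :: "(real \<Rightarrow> real \<Rightarrow> real) \<Rightarrow> real \<Rightarrow> real \<Rightarrow> real" where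
  "partial_xi U t \<xi> = deriv (U t) \<xi>"

text \<open>
  Regularity of classical solutions: \<open>U\<^sub>t\<close>, \<open>U\<^sub>\<xi>\<close> and \<open>U\<^sub>\<xi>\<^sub>\<xi>\<close> exist everywhere and are jointly
  continuous (so \<open>U\<close> is jointly continuous as well).
\<close>

definition C_1_2 :: "(real \<Rightarrow> real \<Rightarrow> real) \<Rightarrow> bool" where
  "C_1_2 U \<longleftrightarrow>
     (\<forall>t \<xi>. (\<lambda>s. U s \<xi>) field_differentiable (at t)) \<and>
     (\<forall>t \<xi>. U t field_differentiable (at \<xi>)) \<and>
     (\<forall>t \<xi>. partial_xi U t field_differentiable (at \<xi>)) \<and>
     continuous_on UNIV (\<lambda>(t, \<xi>). partial_t U t \<xi>) \<and>
     continuous_on UNIV (\<lambda>(t, \<xi>). partial_xi U t \<xi>) \<and>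
     continuous_on UNIV (\<lambda>(t, \<xi>). partial_xi (partial_xi U) t \<xi>)"

definition pulsating_front ::
    "real \<Rightarrow> (real \<Rightarrow> real \<Rightarrow> real) \<Rightarrow> real \<Rightarrow> (real \<Rightarrow> real \<Rightarrow> real) \<Rightarrow> bool" where
  "pulsating_front T f c U \<longleftrightarrow>
     (\<forall>t \<xi>. U t \<xi> \<in> {0..1}) \<and>
     C_1_2 U \<and>
     (\<forall>t \<xi>. partial_t U t \<xi> - c * partial_xi U t \<xi> - partial_xi (partial_xi U) t \<xi>
              - f t (U t \<xi>) = 0) \<and>
     uniform_limit UNIV (\<lambda>\<xi> t. U t \<xi>) (\<lambda>t. 1) at_bot \<and>
     uniform_limit UNIV (\<lambda>\<xi> t. U t \<xi>) (\<lambda>t. 0) at_top \<and>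
     (\<forall>t \<xi>. U (t + T) \<xi> = U t \<xi>)"

end

theory Submission
  imports Defs
begin

text \<open>
  The proof is the sliding method. Let \<open>U\<^sub>1\<close> be a subsolution and \<open>U\<^sub>2\<close> a supersolution of the equation
  with the same speed, both \<open>T\<close>-periodic in time with limits \<open>1\<close> and \<open>0\<close>. Translated far to the
  right, \<open>U\<^sub>2\<close> lies above \<open>U\<^sub>1\<close>. It is moved back as long as the order persists. At the critical shift
  both functions coincide (\<open>critical_shift_coincides\<close>): otherwise the strong maximum principle makes
  the order strict, strictness on a compact space interval survives a slightly smaller shift, and the
  order on that interval extends to the two remaining half-lines.

  This extension (\<open>half_line_comparison\<close>) is where the stability of the states \<open>0\<close> and \<open>1\<close> enters. If
  \<open>U\<^sub>2 < U\<^sub>1\<close> at a point far to the right, both values are close to \<open>0\<close>, and \<open>W = U\<^sub>2 - U\<^sub>1\<close> satisfies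
  \<open>W\<^sub>t - c W\<^sub>\<xi> - W\<^sub>\<xi>\<^sub>\<xi> > \<beta> W\<close> there, with \<open>\<beta>(t) = f\<^sub>u(t,0) + \<mu>\<close> and \<open>- \<mu> < 0\<close> the mean of \<open>f\<^sub>u(\<cdot>,0)\<close>. As
  \<open>\<beta>\<close> has mean zero, \<open>exp (- \<integral>\<beta>)\<close> is periodic, and the product of \<open>W\<close> with it cannot have a negative
  minimum (\<open>periodic_comparison\<close>). The left half-line is treated in the same way at the state \<open>1\<close>.

  The strong maximum principle is proved in a quantitative form with an explicit barrier
  (\<open>positivity_spreads\<close>): a positive lower bound on an interval is passed on to any later point up to
  a factor that does not depend on the solution.

  Comparing a front \<open>U\<close> with its own translates, a coincidence at a positive shift would make \<open>U\<close>
  periodic in \<open>\<xi>\<close>; hence \<open>U\<close> is nonincreasing in \<open>\<xi>\<close>. The quantitative principle, applied to the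
  differences \<open>U(t, \<xi> - h) - U(t, \<xi>)\<close> with a factor independent of \<open>h\<close>, then yields \<open>U\<^sub>\<xi> < 0\<close>. Given two
  fronts with \<open>c\<^sub>2 \<le> c\<^sub>1\<close>, monotonicity makes \<open>U\<^sub>2\<close> a supersolution for the speed \<open>c\<^sub>1\<close>, so \<open>U\<^sub>1\<close> is a
  translate of \<open>U\<^sub>2\<close>, and comparison of the two equations gives \<open>c\<^sub>1 = c\<^sub>2\<close>.
\<close>

text \<open>
  The derivatives are arguments, so that those of translates and of differences of solutions can be
  written down directly.
\<close>

definition parabolic_partials ::
    "(real \<Rightarrow> real \<Rightarrow> real) \<Rightarrow> (real \<Rightarrow> real \<Rightarrow> real) \<Rightarrow> (real \<Rightarrow> real \<Rightarrow> real) \<Rightarrow>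
      (real \<Rightarrow> real \<Rightarrow> real) \<Rightarrow> bool" where
  "parabolic_partials W Wt Wx Wxx \<longleftrightarrow>
     continuous_on UNIV (\<lambda>(t, x). W t x) \<and>
     (\<forall>t x. ((\<lambda>s. W s x) has_real_derivative Wt t x) (at t)) \<and>
     (\<forall>t x. (W t has_real_derivative Wx t x) (at x)) \<and>
     (\<forall>t x. (Wx t has_real_derivative Wxx t x) (at x))"

section \<open>Parabolic maximum principles\<close>

lemma second_derivative_test_at_min:
  fixes g g' :: "real \<Rightarrow> real"
  assumes g: "\<And>y. (g has_real_derivative g' y) (at y)"
    and g': "(g' has_real_derivative D) (at x)"
    and "0 < d" and min: "\<And>y. \<bar>x - y\<bar> < d \<Longrightarrow> g x \<le> g y"
  shows "g' x = 0" and "0 \<le> D"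
proof -
  show *: "g' x = 0"
    using DERIV_local_min[OF g \<open>0 < d\<close>] min by blast
  show "0 \<le> D"
  proof (rule ccontr)
    assume "\<not> 0 \<le> D"
    then obtain e where e: "e > 0" "\<And>h. 0 < h \<Longrightarrow> h < e \<Longrightarrow> g' (x + h) < g' x"
      using DERIV_neg_dec_right[OF g'] by force
    define h where "h = min d e / 2"
    have h: "0 < h" "h < d" "h < e"
      using \<open>0 < d\<close> \<open>e > 0\<close> by (auto simp: h_def)
    obtain z where z: "x < z" "z < x + h" "g (x + h) - g x = (x + h - x) * g' z"
      using MVT2[of x "x + h" g g'] g h by auto
    have "g' z < 0"
      using e(2)[of "z - x"] z h * by auto
    then have "g (x + h) < g x"
      using z(3) h(1) mult_pos_neg[of h "g' z"] by simp
    moreover have "g x \<le> g (x + h)"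
      using min[of "x + h"] h by auto
    ultimately show False by simp
  qed
qed

text \<open>
  Because \<open>\<beta>\<close> has mean zero, the factor \<open>E t = exp (- (\<integral>\<^sub>0\<^sup>t \<beta>))\<close> takes the same value at the times
  \<open>0\<close> and \<open>T\<close>, so \<open>W * E\<close> inherits the periodicity of \<open>W\<close> while the term \<open>\<beta> * W\<close> disappears from its
  equation. If \<open>W\<close> were negative somewhere, the behaviour at infinity would let \<open>W * E\<close> attain a
  negative minimum. There \<open>Wx = 0\<close>, \<open>Wxx \<ge> 0\<close> and \<open>Wt \<le> \<beta> * W\<close>, against the strict inequality.
\<close>

lemma periodic_comparison:
  fixes S :: "real set" and \<beta> :: "real \<Rightarrow> real"
  assumes W: "parabolic_partials W Wt Wx Wxx"
    and "0 < T" and per: "\<And>x. W T x = W 0 x"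
    and \<beta>: "continuous_on {0..T} \<beta>" "integral {0..T} \<beta> = 0"
    and "closed S"
    and bdry: "\<And>t x. t \<in> {0..T} \<Longrightarrow> x \<in> S \<Longrightarrow> x \<notin> interior S \<Longrightarrow> 0 \<le> W t x"
    and far: "\<And>\<epsilon>. 0 < \<epsilon> \<Longrightarrow> \<exists>R. \<forall>t\<in>{0..T}. \<forall>x\<in>S. R \<le> \<bar>x\<bar> \<longrightarrow> - \<epsilon> < W t x"
    and ineq: "\<And>t x. t \<in> {0..T} \<Longrightarrow> x \<in> interior S \<Longrightarrow> W t x < 0 \<Longrightarrow>
                 \<beta> t * W t x < Wt t x - c * Wx t x - Wxx t x"
    and "t \<in> {0..T}" and "x \<in> S"
  shows "0 \<le> W t x"
proof (rule ccontr)
  assume neg: "\<not> 0 \<le> W t x"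
  have cont: "continuous_on UNIV (\<lambda>(t, x). W t x)"
    and dt: "\<And>t x. ((\<lambda>s. W s x) has_real_derivative Wt t x) (at t)"
    and dx: "\<And>t x. (W t has_real_derivative Wx t x) (at x)"
    and dxx: "\<And>t x. (Wx t has_real_derivative Wxx t x) (at x)"
    using W by (auto simp: parabolic_partials_def)
  define E where "E t = exp (- integral {0..t} \<beta>)" for t
  have E_deriv: "(E has_real_derivative - \<beta> t * E t) (at t within {0..T})" if "t \<in> {0..T}" for t
    unfolding E_def using integral_has_real_derivative[OF \<beta>(1) that]
    by (auto intro!: derivative_eq_intros)
  have E_pos: "0 < E t" for t by (simp add: E_def)
  have E_ends: "E 0 = 1" "E T = 1" by (simp_all add: E_def \<beta>)
  have E_cont: "continuous_on {0..T} E"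
    by (rule DERIV_continuous_on[OF E_deriv])
  obtain M where M: "\<And>t. t \<in> {0..T} \<Longrightarrow> E t \<le> M"
    using continuous_attains_sup[OF compact_Icc _ E_cont] \<open>0 < T\<close>
    by (metis atLeastAtMost_iff empty_iff less_eq_real_def)
  have "0 < M" using M[of 0] E_ends \<open>0 < T\<close> by auto
  define V where "V t x = W t x * E t" for t x
  have V_neg: "V t x < 0"
    using neg E_pos by (auto simp: V_def mult_less_0_iff)
  then have "0 < - V t x / M" using \<open>0 < M\<close> by (auto simp: divide_less_0_iff)
  from far[OF this] obtain R
    where R: "\<And>s y. s \<in> {0..T} \<Longrightarrow> y \<in> S \<Longrightarrow> R \<le> \<bar>y\<bar> \<Longrightarrow> V t x / M < W s y"
    by fastforce
  have V_far: "V t x < V s y" if "s \<in> {0..T}" "y \<in> S" "R \<le> \<bar>y\<bar>" for s y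
  proof -
    have "V t x \<le> V t x / M * E s"
      using M[OF that(1)] \<open>0 < M\<close> V_neg by (simp add: field_simps)
    also have "\<dots> < V s y"
      unfolding V_def[of s] using R[OF that] E_pos by (intro mult_strict_right_mono)
    finally show ?thesis .
  qed
  define Q where "Q = {0..T} \<times> (S \<inter> {- max R \<bar>x\<bar>..max R \<bar>x\<bar>})"
  have "compact Q"
    unfolding Q_def using \<open>closed S\<close>
    by (intro compact_Times closed_Int_compact) auto
  moreover have tx: "(t, x) \<in> Q"
    using \<open>t \<in> {0..T}\<close> \<open>x \<in> S\<close> by (auto simp: Q_def)
  moreover have "continuous_on Q (\<lambda>(t, x). V t x)"
  proof -
    have "continuous_on Q (\<lambda>z. W (fst z) (snd z))"
      using continuous_on_subset[OF cont] by (simp add: split_beta)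
    moreover have "continuous_on Q (\<lambda>z. E (fst z))"
      by (rule continuous_on_compose2[OF E_cont]) (auto simp: Q_def intro!: continuous_intros)
    ultimately show ?thesis
      by (auto simp: V_def split_beta intro!: continuous_intros)
  qed
  ultimately obtain z where "z \<in> Q" "\<forall>z'\<in>Q. (\<lambda>(t, x). V t x) z \<le> (\<lambda>(t, x). V t x) z'"
    using continuous_attains_inf[of Q "\<lambda>(t, x). V t x"] by blast
  then obtain t0 x0 where z: "(t0, x0) \<in> Q"
      "\<And>s y. (s, y) \<in> Q \<Longrightarrow> V t0 x0 \<le> V s y"
    by (cases z) fastforce
  have x0: "x0 \<in> S" and t0: "t0 \<in> {0..T}" using z(1) by (auto simp: Q_def)
  \<comment> \<open>A minimum at time \<open>0\<close> is also one at time \<open>T\<close>; the time derivative is tested against earlier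
    times, so a positive time is chosen.\<close>
  define t1 where "t1 = (if t0 = 0 then T else t0)"
  have t1: "0 < t1" "t1 \<in> {0..T}" using t0 \<open>0 < T\<close> by (auto simp: t1_def)
  have V1: "V t1 x0 = V t0 x0"
    by (auto simp: t1_def V_def E_ends per)
  have V_min: "V t1 x0 \<le> V s y" if "s \<in> {0..T}" "y \<in> S" for s y
  proof (cases "R \<le> \<bar>y\<bar>")
    case True
    then show ?thesis using V_far[OF that True] z(2)[OF tx] V1 by simp
  next
    case False
    then have "(s, y) \<in> Q" using that by (auto simp: Q_def)
    then show ?thesis using z(2) V1 by simp
  qed
  have "V t1 x0 < 0"
    using V_min[OF \<open>t \<in> {0..T}\<close> \<open>x \<in> S\<close>] V_neg by simp
  then have W_neg: "W t1 x0 < 0"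
    using E_pos[of t1] by (auto simp: V_def mult_less_0_iff)
  have int: "x0 \<in> interior S"
    using bdry[OF t1(2) x0] W_neg by force
  then obtain d where d: "0 < d" "ball x0 d \<subseteq> S"
    by (meson mem_interior)
  have "W t1 x0 \<le> W t1 y" if "\<bar>x0 - y\<bar> < d" for y
  proof -
    have "y \<in> S" using that d by (auto simp: dist_real_def)
    then show ?thesis using V_min[OF t1(2)] E_pos[of t1] by (simp add: V_def)
  qed
  then have X: "Wx t1 x0 = 0" "0 \<le> Wxx t1 x0"
    using second_derivative_test_at_min[OF dx dxx d(1)] by blast+
  have V_deriv: "((\<lambda>s. V s x0) has_real_derivative (Wt t1 x0 - \<beta> t1 * W t1 x0) * E t1)
          (at t1 within {0..T})"
    unfolding V_def
    by (rule derivative_eq_intros has_field_derivative_at_within[OF dt] E_deriv t1 refl)+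
      (simp add: algebra_simps)
  have "\<not> 0 < (Wt t1 x0 - \<beta> t1 * W t1 x0) * E t1"
  proof
    assume "0 < (Wt t1 x0 - \<beta> t1 * W t1 x0) * E t1"
    from has_real_derivative_pos_inc_left[OF V_deriv this] obtain e where e: "0 < e"
        "\<And>h. 0 < h \<Longrightarrow> t1 - h \<in> {0..T} \<Longrightarrow> h < e \<Longrightarrow> V (t1 - h) x0 < V t1 x0"
      by blast
    define h where "h = min t1 e / 2"
    have "0 < h" "h < e" "t1 - h \<in> {0..T}"
      using t1 \<open>0 < e\<close> by (auto simp: h_def)
    then show False using e(2)[of h] V_min[OF _ x0, of "t1 - h"] by force
  qed
  then have "Wt t1 x0 \<le> \<beta> t1 * W t1 x0"
    using E_pos[of t1] by (simp add: zero_less_mult_iff)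
  then show False
    using ineq[OF t1(2) int W_neg] X by simp
qed

text \<open>
  A quantitative strong maximum principle. A bump of width \<open>2 * r\<close> is carried along the straight line
  from \<open>(s, x1)\<close> to \<open>(t, x0)\<close>. In the frame moving with it, \<open>exp (- a * y) * cos (k * y)\<close> is an
  eigenfunction of the space operator that vanishes for \<open>\<bar>y\<bar> = r\<close>; damped fast enough in time
  it becomes a strict subsolution \<open>B\<close> with explicit derivatives. The comparison of \<open>W\<close> with
  \<open>\<epsilon> * B\<close> takes place on the compact parallelogram \<open>\<bar>y\<bar> \<le> r\<close>. The constant \<open>\<kappa>\<close> is the height of
  \<open>B\<close> on arrival; it depends neither on \<open>W\<close> nor on \<open>\<epsilon>\<close>, which later permits a passage to the limit
  in difference quotients.
\<close>

lemma positivity_spreads: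
  fixes K r s t c x0 x1 :: real
  assumes "0 \<le> K" "0 < r" "s < t"
  obtains \<kappa> where "0 < \<kappa>"
    and "\<And>W Wt Wx Wxx \<epsilon>. parabolic_partials W Wt Wx Wxx \<Longrightarrow> (\<And>t x. 0 \<le> W t x) \<Longrightarrow>
           (\<And>t x. - K * W t x \<le> Wt t x - c * Wx t x - Wxx t x) \<Longrightarrow>
           0 < \<epsilon> \<Longrightarrow> (\<And>x. \<bar>x - x1\<bar> \<le> r \<Longrightarrow> \<epsilon> \<le> W s x) \<Longrightarrow> \<kappa> * \<epsilon> \<le> W t x0"
proof -
  define v where "v = (x0 - x1) / (t - s)"
  \<comment> \<open>The exponent \<open>a\<close> removes the drift \<open>c + v\<close> felt in the moving frame, and \<open>k\<close> puts the first zeros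
    of the cosine at \<open>y = r\<close> and \<open>y = - r\<close>. The decay rate \<open>\<mu>\<close> makes \<open>B\<close> an exact solution with
    zeroth-order coefficient \<open>- (K + 1)\<close>; the surplus \<open>1\<close> gives strictness.\<close>
  define a where "a = (c + v) / 2"
  define k where "k = pi / (2 * r)"
  define \<mu> where "\<mu> = K + 1 + a\<^sup>2 + k\<^sup>2"
  define y where "y t x = x - x1 - v * (t - s)" for t x
  \<comment> \<open>The term \<open>\<bar>a\<bar> * r\<close> normalises the barrier to be at most \<open>1\<close> at the initial time \<open>s\<close>.\<close>
  define E where "E t x = exp (- \<mu> * (t - s) - a * y t x - \<bar>a\<bar> * r)" for t x
  define B where "B t x = E t x * cos (k * y t x)" for t x
  define Bt where "Bt t x = (- \<mu> + a * v) * B t x + k * v * (E t x * sin (k * y t x))" for t x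
  define Bx where "Bx t x = - a * B t x - k * (E t x * sin (k * y t x))" for t x
  define Bxx where
    "Bxx t x = (a\<^sup>2 - k\<^sup>2) * B t x + 2 * a * k * (E t x * sin (k * y t x))" for t x
  have B_dt: "((\<lambda>s. B s x) has_real_derivative Bt t x) (at t)" for t x
    unfolding B_def E_def y_def Bt_def
    by (auto intro!: derivative_eq_intros simp: algebra_simps)
  have B_dx: "(B t has_real_derivative Bx t x) (at x)" for t x
    unfolding B_def E_def y_def Bx_def
    by (auto intro!: derivative_eq_intros simp: algebra_simps)
  have B_dxx: "(Bx t has_real_derivative Bxx t x) (at x)" for t x
    unfolding Bx_def[abs_def] B_def E_def y_def Bxx_def
    by (auto intro!: derivative_eq_intros simp: algebra_simps power2_eq_square)
  have B_op: "Bt t x - c * Bx t x - Bxx t x = - (K + 1) * B t x" for t x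
  proof -
    have "Bt t x - (2 * a - v) * Bx t x - Bxx t x = - (K + 1) * B t x"
      unfolding Bt_def Bx_def Bxx_def \<mu>_def by (simp add: algebra_simps power2_eq_square)
    moreover have "2 * a - v = c" by (simp add: a_def field_simps)
    ultimately show ?thesis by simp
  qed
  have B_pos: "0 < B t x" if "\<bar>y t x\<bar> < r" for t x
  proof -
    have "\<bar>k * y t x\<bar> < pi / 2"
      using that \<open>0 < r\<close> by (simp add: k_def abs_mult field_simps)
    then have "0 < cos (k * y t x)" by (intro cos_gt_zero_pi) auto
    then show ?thesis by (simp add: B_def E_def)
  qed
  have B_side: "B t x = 0" if "\<bar>y t x\<bar> = r" for t x
  proof -
    have "\<bar>k * y t x\<bar> = pi / 2"
      using that \<open>0 < r\<close> by (simp add: k_def abs_mult field_simps)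
    then have "cos (k * y t x) = 0" by (metis cos_abs_real cos_pi_half)
    then show ?thesis by (simp add: B_def)
  qed
  have B_le1: "B s x \<le> 1" if "\<bar>y s x\<bar> \<le> r" for x
  proof -
    have "- (a * y s x) \<le> \<bar>a * y s x\<bar>" by simp
    also have "\<dots> \<le> \<bar>a\<bar> * r" using that by (simp add: abs_mult mult_left_mono)
    finally have "E s x \<le> 1" by (simp add: E_def)
    moreover have "B s x \<le> E s x * 1"
      unfolding B_def by (intro mult_left_mono) (auto simp: E_def)
    ultimately show ?thesis by simp
  qed
  have y_end: "y t x0 = 0" using \<open>s < t\<close> by (simp add: y_def v_def)
  have \<kappa>: "0 < B t x0" by (rule B_pos) (simp add: y_end \<open>0 < r\<close>)
  define D where "D = {z. s \<le> fst z \<and> fst z \<le> t \<and> \<bar>y (fst z) (snd z)\<bar> \<le> r}"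
  have D_compact: "compact D"
  proof -
    define L where "L = r + \<bar>x1\<bar> + \<bar>v\<bar> * (t - s)"
    have "closed D"
      unfolding D_def y_def by (intro closed_Collect_conj closed_Collect_le continuous_intros)
    moreover have "D \<subseteq> {s..t} \<times> {- L..L}"
    proof
      fix z assume "z \<in> D"
      then have z: "s \<le> fst z" "fst z \<le> t" "\<bar>y (fst z) (snd z)\<bar> \<le> r" by (auto simp: D_def)
      have "\<bar>v * (fst z - s)\<bar> \<le> \<bar>v\<bar> * (t - s)"
        using z by (simp add: abs_mult mult_left_mono)
      then have "\<bar>snd z\<bar> \<le> L"
        using z(3) unfolding L_def y_def by linarith
      then show "z \<in> {s..t} \<times> {- L..L}" using z by (cases z) auto
    qed
    then have "bounded D"
      by (rule bounded_subset[rotated]) (auto intro!: bounded_Times)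
    ultimately show ?thesis by (simp add: compact_eq_bounded_closed)
  qed
  have "B t x0 * \<epsilon> \<le> W t x0"
    if W: "parabolic_partials W Wt Wx Wxx" and W0: "\<And>t x. 0 \<le> W t x"
      and ineq: "\<And>t x. - K * W t x \<le> Wt t x - c * Wx t x - Wxx t x"
      and "0 < \<epsilon>" and init: "\<And>x. \<bar>x - x1\<bar> \<le> r \<Longrightarrow> \<epsilon> \<le> W s x"
    for W Wt Wx Wxx \<epsilon>
  proof (rule ccontr)
    assume neg: "\<not> B t x0 * \<epsilon> \<le> W t x0"
    have cont: "continuous_on UNIV (\<lambda>(t, x). W t x)"
      and dt: "\<And>t x. ((\<lambda>s. W s x) has_real_derivative Wt t x) (at t)"
      and dx: "\<And>t x. (W t has_real_derivative Wx t x) (at x)"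
      and dxx: "\<And>t x. (Wx t has_real_derivative Wxx t x) (at x)"
      using W by (auto simp: parabolic_partials_def)
    define Z where "Z t x = W t x - \<epsilon> * B t x" for t x
    have "continuous_on D (\<lambda>z. W (fst z) (snd z))"
      using continuous_on_subset[OF cont] by (simp add: split_beta)
    then have "continuous_on D (\<lambda>z. Z (fst z) (snd z))"
      unfolding Z_def B_def E_def y_def by (intro continuous_intros)
    moreover have "(t, x0) \<in> D" using \<open>s < t\<close> \<open>0 < r\<close> by (simp add: D_def y_end)
    ultimately obtain z where z: "z \<in> D" "\<And>z'. z' \<in> D \<Longrightarrow> Z (fst z) (snd z) \<le> Z (fst z') (snd z')"
      using continuous_attains_inf[OF D_compact, of "\<lambda>z. Z (fst z) (snd z)"] by blast
    define t1 where "t1 = fst z"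
    define z1 where "z1 = snd z"
    have min: "Z t1 z1 \<le> Z t' x'" if "s \<le> t'" "t' \<le> t" "\<bar>y t' x'\<bar> \<le> r" for t' x'
      using z(2)[of "(t', x')"] that by (simp add: D_def t1_def z1_def)
    have z1: "s \<le> t1" "t1 \<le> t" "\<bar>y t1 z1\<bar> \<le> r"
      using z(1) by (auto simp: D_def t1_def z1_def)
    have Z_neg: "Z t1 z1 < 0"
      using neg min[of t x0] \<open>s < t\<close> \<open>0 < r\<close> by (simp add: y_end Z_def mult.commute)
    have inner: "\<bar>y t1 z1\<bar> < r"
    proof (rule ccontr)
      assume "\<not> ?thesis"
      then have "B t1 z1 = 0" using z1 by (intro B_side) simp
      then show False using Z_neg W0[of t1 z1] by (simp add: Z_def)
    qed
    have "s < t1"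
    proof (rule ccontr)
      assume "\<not> s < t1"
      then have [simp]: "t1 = s" using z1 by simp
      have "\<epsilon> \<le> W s z1" using init z1(3) by (simp add: y_def)
      moreover have "\<epsilon> * B s z1 \<le> \<epsilon> * 1"
        using B_le1 z1(3) \<open>0 < \<epsilon>\<close> by (intro mult_left_mono) auto
      ultimately show False using Z_neg by (simp add: Z_def)
    qed
    have Zx: "(Z t1 has_real_derivative Wx t1 x - \<epsilon> * Bx t1 x) (at x)" for x
      unfolding Z_def[abs_def] by (intro DERIV_diff DERIV_cmult dx B_dx)
    have Zxx: "((\<lambda>x. Wx t1 x - \<epsilon> * Bx t1 x) has_real_derivative Wxx t1 x - \<epsilon> * Bxx t1 x) (at x)" for x
      by (intro DERIV_diff DERIV_cmult dxx B_dxx)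
    have Zt: "((\<lambda>t. Z t z1) has_real_derivative Wt t1 z1 - \<epsilon> * Bt t1 z1) (at t1)"
      unfolding Z_def by (intro DERIV_diff DERIV_cmult dt B_dt)
    have X: "Wx t1 z1 - \<epsilon> * Bx t1 z1 = 0" "0 \<le> Wxx t1 z1 - \<epsilon> * Bxx t1 z1"
    proof -
      have "Z t1 z1 \<le> Z t1 x" if "\<bar>z1 - x\<bar> < r - \<bar>y t1 z1\<bar>" for x
      proof (rule min)
        show "\<bar>y t1 x\<bar> \<le> r" using that unfolding y_def by linarith
      qed (use z1 in auto)
      then show "Wx t1 z1 - \<epsilon> * Bx t1 z1 = 0" "0 \<le> Wxx t1 z1 - \<epsilon> * Bxx t1 z1"
        using second_derivative_test_at_min[OF Zx Zxx, of "r - \<bar>y t1 z1\<bar>" z1] inner by auto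
    qed
    have "\<not> 0 < Wt t1 z1 - \<epsilon> * Bt t1 z1"
    proof
      assume "0 < Wt t1 z1 - \<epsilon> * Bt t1 z1"
      from DERIV_pos_inc_left[OF Zt this] obtain e where e: "0 < e"
        "\<And>h. 0 < h \<Longrightarrow> h < e \<Longrightarrow> Z (t1 - h) z1 < Z t1 z1" by blast
      \<comment> \<open>Going back in time by less than \<open>q\<close> at a fixed place does not leave the moving strip.\<close>
      define q where "q = (r - \<bar>y t1 z1\<bar>) / (\<bar>v\<bar> + 1)"
      have "0 < q" using inner by (simp add: q_def)
      define h where "h = min e (min (t1 - s) q) / 2"
      have h: "0 < h" "h < e" "h < t1 - s" "h < q"
        using \<open>0 < e\<close> \<open>s < t1\<close> \<open>0 < q\<close> by (auto simp: h_def)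
      have "\<bar>v\<bar> * h + h < r - \<bar>y t1 z1\<bar>"
        using h(4) by (simp add: q_def field_simps)
      moreover have "\<bar>v * h\<bar> = \<bar>v\<bar> * h" using h(1) by (simp add: abs_mult)
      moreover have "y (t1 - h) z1 = y t1 z1 + v * h" by (simp add: y_def algebra_simps)
      ultimately have "\<bar>y (t1 - h) z1\<bar> \<le> r" using h(1) by linarith
      then have "Z t1 z1 \<le> Z (t1 - h) z1" using h z1 by (intro min) auto
      then show False using e(2)[of h] h by simp
    qed
    then have "Wt t1 z1 - c * Wx t1 z1 - Wxx t1 z1 - \<epsilon> * (Bt t1 z1 - c * Bx t1 z1 - Bxx t1 z1) \<le> 0"
      using X by (simp add: algebra_simps)
    then have "- K * W t1 z1 + \<epsilon> * ((K + 1) * B t1 z1) \<le> 0"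
      using ineq[of t1 z1] unfolding B_op by (simp add: algebra_simps)
    then have "- K * Z t1 z1 + \<epsilon> * B t1 z1 \<le> 0"
      by (simp add: Z_def algebra_simps)
    moreover have "0 \<le> - K * Z t1 z1"
      using Z_neg \<open>0 \<le> K\<close> by (simp add: mult_nonneg_nonpos)
    moreover have "0 < \<epsilon> * B t1 z1"
      using B_pos[OF inner] \<open>0 < \<epsilon>\<close> by simp
    ultimately show False by simp
  qed
  with \<kappa> show thesis by (rule that) 
qed

section \<open>Classical solutions, translations and periodicity\<close>

text \<open>
  The point is the joint continuity of \<open>U\<close> itself: one partial derivative together with the continuity
  of the other yields total differentiability.
\<close>

lemma C_1_2_parabolic_partials:
  assumes "C_1_2 U"
  shows "parabolic_partials U (partial_t U) (partial_xi U) (partial_xi (partial_xi U))"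
proof -
  have dt: "((\<lambda>s. U s x) has_real_derivative partial_t U t x) (at t)" for t x
    using assms by (auto simp: C_1_2_def partial_t_def field_differentiable_derivI)
  have dx: "(U t has_real_derivative partial_xi U t x) (at x)" for t x
    using assms by (auto simp: C_1_2_def partial_xi_def field_differentiable_derivI)
  have dxx: "(partial_xi U t has_real_derivative partial_xi (partial_xi U) t x) (at x)" for t x
    using assms by (auto simp: C_1_2_def partial_xi_def[of "partial_xi U"] field_differentiable_derivI)
  have cont: "continuous_on UNIV (\<lambda>z. partial_xi U (fst z) (snd z))"
    using assms by (simp add: C_1_2_def split_beta)
  have "continuous (at (t, x)) (\<lambda>(t, x). U t x)" for t x
  proof -
    have "((\<lambda>(t, x). U t x) has_derivative
            (\<lambda>(h, k). partial_t U t x * h + blinfun_mult_right (partial_xi U t x) k))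
          (at (t, x) within UNIV \<times> UNIV)"
    proof (rule has_derivative_partialsI)
      show "((\<lambda>t. U t x) has_derivative (*) (partial_t U t x)) (at t)"
        using dt by (simp add: has_field_derivative_def)
      show "((\<lambda>x. U s x) has_derivative blinfun_apply (blinfun_mult_right (partial_xi U s y))) (at y)"
        for s y
        using dx by (simp add: has_field_derivative_def)
      have "continuous_on UNIV (\<lambda>z. blinfun_mult_right (partial_xi U (fst z) (snd z)))"
        by (intro bounded_linear.continuous_on[OF bounded_linear_blinfun_mult_right] cont)
      then show "continuous (at (t, x) within UNIV \<times> UNIV)
                   (\<lambda>(t, x). blinfun_mult_right (partial_xi U t x))"
        by (simp add: case_prod_unfold continuous_on_eq_continuous_at)
    qed auto
    then show ?thesis using has_derivative_continuous by fastforce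
  qed
  then have "continuous_on UNIV (\<lambda>(t, x). U t x)"
    by (simp add: continuous_on_eq_continuous_within)
  with dt dx dxx show ?thesis by (simp add: parabolic_partials_def)
qed

lemma parabolic_partials_shift:
  assumes "parabolic_partials W Wt Wx Wxx"
  shows "parabolic_partials (\<lambda>t x. W t (x - h)) (\<lambda>t x. Wt t (x - h))
           (\<lambda>t x. Wx t (x - h)) (\<lambda>t x. Wxx t (x - h))"
proof -
  have cont: "continuous_on UNIV (\<lambda>z. W (fst z) (snd z))"
    using assms by (simp add: parabolic_partials_def split_beta)
  have "continuous_on UNIV (\<lambda>z. W (fst (fst z, snd z - h)) (snd (fst z, snd z - h)))"
    by (rule continuous_on_compose2[OF cont, of _ "\<lambda>z. (fst z, snd z - h)"])
      (auto intro!: continuous_intros)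
  moreover have "((\<lambda>x. g (x - h)) has_real_derivative g' (x - h)) (at x)"
    if "\<And>x. (g has_real_derivative g' x) (at x)" for g g' x
    using that[of "x - h"] DERIV_shift[of g _ x "- h"] by simp
  ultimately show ?thesis
    using assms by (auto simp: parabolic_partials_def split_beta)
qed

lemma parabolic_partials_diff:
  assumes "parabolic_partials V Vt Vx Vxx" and "parabolic_partials W Wt Wx Wxx"
  shows "parabolic_partials (\<lambda>t x. V t x - W t x) (\<lambda>t x. Vt t x - Wt t x)
           (\<lambda>t x. Vx t x - Wx t x) (\<lambda>t x. Vxx t x - Wxx t x)"
  using assms unfolding parabolic_partials_def split_beta
  by (auto intro!: continuous_on_diff DERIV_diff)

text \<open>
  The type of the values is arbitrary because the lemma is mostly applied to the curve of pairs
  \<open>t \<mapsto> (U\<^sub>1 t, U\<^sub>2 t)\<close>, which moves two fronts to the same time at once.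
\<close>

lemma periodic_representative:
  fixes g :: "real \<Rightarrow> 'a"
  assumes "0 < T" and per: "\<And>t. g (t + T) = g t"
  obtains s where "s \<in> {a..a + T}" and "g s = g t"
proof -
  have fwd: "g (t + real n * T) = g t" for t n
  proof (induction n)
    case (Suc n)
    have "g (t + real (Suc n) * T) = g ((t + real n * T) + T)" by (simp add: algebra_simps)
    with Suc per show ?case by simp
  qed simp
  have int: "g (t + of_int k * T) = g t" for k
  proof (cases "0 \<le> k")
    case True
    then show ?thesis using fwd[of t "nat k"] by simp
  next
    case False
    then show ?thesis using fwd[of "t + of_int k * T" "nat (- k)"] by (simp add: algebra_simps)
  qed
  define k where "k = \<lfloor>(t - a) / T\<rfloor>"
  have "of_int k \<le> (t - a) / T" "(t - a) / T \<le> of_int k + 1"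
    by (auto simp: k_def)
  then have "t + of_int (- k) * T \<in> {a..a + T}"
    using \<open>0 < T\<close> by (simp add: field_simps)
  then show thesis using int by (rule that)
qed

section \<open>The reaction term\<close>

text \<open>
  The partial derivative in \<open>u\<close> is the parameter \<open>fu\<close>; at the end points of \<open>[0,1]\<close> it is one-sided.
  Its continuity in \<open>u\<close> is uniform in time.
\<close>

locale periodic_reaction =
  fixes T :: real and f fu :: "real \<Rightarrow> real \<Rightarrow> real"
  assumes T_pos: "0 < T"
    and f_periodic: "\<And>t u. u \<in> {0..1} \<Longrightarrow> f (t + T) u = f t u"
    and f_continuous: "\<And>u. u \<in> {0..1} \<Longrightarrow> continuous_on UNIV (\<lambda>t. f t u)"
    and f_deriv: "\<And>t u. u \<in> {0..1} \<Longrightarrow> (f t has_real_derivative fu t u) (at u within {0..1})"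
    and fu_modulus: "\<And>u. u \<in> {0..1} \<Longrightarrow>
          uniform_limit UNIV (\<lambda>v t. fu t v) (\<lambda>t. fu t u) (at u within {0..1})"
begin

lemma fu_equicontinuous:
  assumes "u \<in> {0..1}" "0 < \<epsilon>"
  obtains \<delta> where "0 < \<delta>"
    and "\<And>t v. v \<in> {0..1} \<Longrightarrow> \<bar>v - u\<bar> < \<delta> \<Longrightarrow> \<bar>fu t v - fu t u\<bar> < \<epsilon>"
proof -
  from uniform_limitD[OF fu_modulus[OF assms(1)] assms(2)]
  obtain \<delta> where "0 < \<delta>" and
    \<delta>: "\<And>v t. v \<in> {0..1} \<Longrightarrow> v \<noteq> u \<Longrightarrow> \<bar>v - u\<bar> < \<delta> \<Longrightarrow> \<bar>fu t v - fu t u\<bar> < \<epsilon>"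
    by (auto simp: eventually_at dist_real_def)
  then show thesis using that[of \<delta>] \<open>0 < \<epsilon>\<close> by (metis abs_zero diff_self)
qed

lemma f_mvt:
  assumes "0 \<le> u" "u < v" "v \<le> 1"
  obtains w where "u < w" "w < v" "f t v - f t u = fu t w * (v - u)"
proof -
  have "\<exists>w\<in>{u<..<v}. f t v - f t u = (*) (fu t w) (v - u)"
  proof (rule mvt_simple)
    fix w assume "u \<le> w" "w \<le> v"
    then have "(f t has_real_derivative fu t w) (at w within {u..v})"
      using assms by (intro has_field_derivative_subset[OF f_deriv]) auto
    then show "(f t has_derivative (*) (fu t w)) (at w within {u..v})"
      by (simp add: has_field_derivative_def)
  qed fact
  then show thesis using that by auto
qed

lemma fu_periodic:
  assumes "u \<in> {0..1}"
  shows "fu (t + T) u = fu t u"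
proof -
  have "(f t has_real_derivative fu (t + T) u) (at u within {0..1})"
    using assms
    by (intro has_field_derivative_transform_within[OF f_deriv, where d = 1]) (auto simp: f_periodic)
  moreover have "at u within {0..1} \<noteq> bot"
    using assms by (simp add: trivial_limit_within islimpt_Icc)
  ultimately show ?thesis
    using f_deriv[OF assms] has_field_derivative_unique by blast
qed

text \<open>
  The difference quotients of \<open>f\<close> in \<open>u\<close> are continuous in time, and by the mean value theorem and
  the modulus of continuity of \<open>fu\<close> they converge to \<open>fu\<close> uniformly in time.
\<close>

lemma fu_continuous_in_time:
  assumes u: "u \<in> {0..1}"
  shows "continuous_on UNIV (\<lambda>t. fu t u)"
proof (rule uniform_limit_theorem)
  let ?q = "\<lambda>v t. (f t v - f t u) / (v - u)"
  show "\<forall>\<^sub>F v in at u within {0..1}. continuous_on UNIV (?q v)"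
    using u by (auto simp: eventually_at intro!: exI[of _ 1] continuous_intros f_continuous)
  show "at u within {0..1} \<noteq> bot"
    using u by (simp add: trivial_limit_within islimpt_Icc)
  show "uniform_limit UNIV ?q (\<lambda>t. fu t u) (at u within {0..1})"
  proof (rule uniform_limitI)
    fix \<epsilon> :: real assume "0 < \<epsilon>"
    obtain \<delta> where "0 < \<delta>"
      and \<delta>: "\<And>t v. v \<in> {0..1} \<Longrightarrow> \<bar>v - u\<bar> < \<delta> \<Longrightarrow> \<bar>fu t v - fu t u\<bar> < \<epsilon>"
      using fu_equicontinuous[OF u \<open>0 < \<epsilon>\<close>] by blast
    have "\<bar>?q v t - fu t u\<bar> < \<epsilon>" if v: "v \<in> {0..1}" "v \<noteq> u" "\<bar>v - u\<bar> < \<delta>" for v t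
    proof -
      obtain w where "w \<in> {0..1}" "\<bar>w - u\<bar> < \<delta>" "?q v t = fu t w"
      proof (cases "u < v")
        case True
        then obtain w where w: "u < w" "w < v" "f t v - f t u = fu t w * (v - u)"
          using f_mvt u v by (metis atLeastAtMost_iff)
        show ?thesis
          by (rule that[of w]) (use w u v in auto)
      next
        case False
        then have "v < u" using v by simp
        then obtain w where w: "v < w" "w < u" "f t u - f t v = fu t w * (u - v)"
          using f_mvt u v by (metis atLeastAtMost_iff)
        have "?q v t = (f t u - f t v) / (u - v)"
          by (metis minus_diff_eq minus_divide_divide)
        then show ?thesis
          by (intro that[of w]) (use w u v in auto)
      qed
      then show ?thesis using \<delta> by metis
    qed
    then show "\<forall>\<^sub>F v in at u within {0..1}. \<forall>t\<in>UNIV. dist (?q v t) (fu t u) < \<epsilon>"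
      unfolding eventually_at dist_real_def using \<open>0 < \<delta>\<close> by blast
  qed
qed

text \<open>
  Continuity in time and equicontinuity in \<open>u\<close> make \<open>fu\<close> jointly continuous, hence bounded on the
  compact set \<open>[0,T] \<times> [0,1]\<close>; periodicity extends the bound to all times.
\<close>

lemma fu_bounded:
  obtains K where "0 \<le> K" and "\<And>t u. u \<in> {0..1} \<Longrightarrow> \<bar>fu t u\<bar> \<le> K"
proof -
  have "continuous_on ({0..T} \<times> {0..1}) (\<lambda>z. fu (fst z) (snd z))"
    unfolding continuous_on_iff
  proof (intro ballI allI impI)
    fix z :: "real \<times> real" and \<epsilon> :: real
    assume z: "z \<in> {0..T} \<times> {0..1}" and "0 < \<epsilon>"
    obtain t u where [simp]: "z = (t, u)" by (cases z)
    have u: "u \<in> {0..1}" and e: "0 < \<epsilon> / 2" using z \<open>0 < \<epsilon>\<close> by auto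
    obtain \<delta> where "0 < \<delta>"
      and \<delta>: "\<And>t v. v \<in> {0..1} \<Longrightarrow> \<bar>v - u\<bar> < \<delta> \<Longrightarrow> \<bar>fu t v - fu t u\<bar> < \<epsilon> / 2"
      using fu_equicontinuous[OF u e] by blast
    obtain \<eta> where "0 < \<eta>" and \<eta>: "\<And>s. \<bar>s - t\<bar> < \<eta> \<Longrightarrow> \<bar>fu s u - fu t u\<bar> < \<epsilon> / 2"
      using fu_continuous_in_time[OF u] e unfolding continuous_on_iff dist_real_def
      by (metis UNIV_I)
    have "\<bar>fu s v - fu t u\<bar> < \<epsilon>" if "v \<in> {0..1}" "dist (s, v) (t, u) < min \<delta> \<eta>" for s v
    proof -
      have "\<bar>v - u\<bar> < \<delta>" "\<bar>s - t\<bar> < \<eta>"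
        using that(2) dist_fst_le[of "(s, v)" "(t, u)"] dist_snd_le[of "(s, v)" "(t, u)"]
        by (auto simp: dist_real_def)
      then show ?thesis using \<delta>[OF that(1), of s] \<eta>[of s] by linarith
    qed
    then show "\<exists>d>0. \<forall>z'\<in>{0..T} \<times> {0..1}.
                 dist z' z < d \<longrightarrow> dist (fu (fst z') (snd z')) (fu (fst z) (snd z)) < \<epsilon>"
      using \<open>0 < \<delta>\<close> \<open>0 < \<eta>\<close>
      by (intro exI[of _ "min \<delta> \<eta>"]) (auto simp: dist_real_def)
  qed
  then have "bounded ((\<lambda>z. fu (fst z) (snd z)) ` ({0..T} \<times> {0..1}))"
    by (intro compact_imp_bounded compact_continuous_image compact_Times compact_Icc)
  then obtain K where K: "\<And>s u. s \<in> {0..T} \<Longrightarrow> u \<in> {0..1} \<Longrightarrow> \<bar>fu s u\<bar> \<le> K"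
    by (force simp: bounded_iff)
  have "\<bar>fu t u\<bar> \<le> \<bar>K\<bar>" if u: "u \<in> {0..1}" for t u
  proof -
    obtain s where "s \<in> {0..0 + T}" "fu s u = fu t u"
      using periodic_representative[of T "\<lambda>t. fu t u" 0 t] T_pos fu_periodic[OF u] by metis
    then show ?thesis using K[of s u] u by simp
  qed
  then show thesis by (intro that[of "\<bar>K\<bar>"]) auto
qed

text \<open>
  For an ordered pair of solutions this turns the difference of the reaction terms into a
  zeroth-order term \<open>- K * W\<close>, as required by \<open>positivity_spreads\<close>.
\<close>

lemma f_lower_lipschitz:
  obtains K where "0 \<le> K"
    and "\<And>t u v. 0 \<le> u \<Longrightarrow> u \<le> v \<Longrightarrow> v \<le> 1 \<Longrightarrow> - K * (v - u) \<le> f t v - f t u"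
proof -
  obtain K where K: "0 \<le> K" "\<And>t u. u \<in> {0..1} \<Longrightarrow> \<bar>fu t u\<bar> \<le> K"
    using fu_bounded by blast
  have "- K * (v - u) \<le> f t v - f t u" if uv: "0 \<le> u" "u \<le> v" "v \<le> 1" for t u v
  proof (cases "u = v")
    case False
    then obtain w where w: "u < w" "w < v" "f t v - f t u = fu t w * (v - u)"
      using f_mvt[of u v t] uv by auto
    have "- K \<le> fu t w" using K(2)[of w t] w uv by simp
    then show ?thesis using w uv by (simp only: w(3) mult_right_mono)
  qed simp
  with K(1) show thesis by (rule that)
qed

text \<open>
  The rate is \<open>\<beta> t = fu t e + \<mu>\<close>, where \<open>- \<mu> < 0\<close> is the mean of \<open>fu\<close> at \<open>e\<close>. Raising \<open>fu\<close> by \<open>\<mu>\<close>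
  brings the mean to zero, and the room \<open>\<mu>\<close> thus gained absorbs the variation of \<open>fu\<close> near \<open>e\<close>.
\<close>

lemma stable_state_zero_mean_rate:
  assumes e: "e \<in> {0..1}" and stable: "integral {0..T} (\<lambda>s. fu s e) < 0"
  obtains \<beta> \<delta> where "continuous_on {0..T} \<beta>" and "integral {0..T} \<beta> = 0" and "0 < \<delta>"
    and "\<And>t u v. 0 \<le> u \<Longrightarrow> u < v \<Longrightarrow> v \<le> 1 \<Longrightarrow> \<bar>u - e\<bar> < \<delta> \<Longrightarrow> \<bar>v - e\<bar> < \<delta> \<Longrightarrow>
           f t v - f t u < \<beta> t * (v - u)"
proof -
  define \<mu> where "\<mu> = - integral {0..T} (\<lambda>s. fu s e) / T"
  have "0 < \<mu>" using divide_neg_pos[OF stable T_pos] by (simp add: \<mu>_def)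
  have cont: "continuous_on {0..T} (\<lambda>s. fu s e)"
    using continuous_on_subset[OF fu_continuous_in_time[OF e]] by blast
  obtain \<delta> where "0 < \<delta>"
    and \<delta>: "\<And>t v. v \<in> {0..1} \<Longrightarrow> \<bar>v - e\<bar> < \<delta> \<Longrightarrow> \<bar>fu t v - fu t e\<bar> < \<mu>"
    using fu_equicontinuous[OF e \<open>0 < \<mu>\<close>] by blast
  show thesis
  proof (rule that[of "\<lambda>t. fu t e + \<mu>" \<delta>])
    show "continuous_on {0..T} (\<lambda>t. fu t e + \<mu>)" by (intro continuous_intros cont)
    have "integral {0..T} (\<lambda>t. fu t e + \<mu>) = integral {0..T} (\<lambda>t. fu t e) + integral {0..T} (\<lambda>t. \<mu>)"
      by (intro integral_add integrable_continuous_real cont continuous_intros)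
    also have "\<dots> = 0" using T_pos by (simp add: \<mu>_def)
    finally show "integral {0..T} (\<lambda>t. fu t e + \<mu>) = 0" .
    show "0 < \<delta>" by fact
    fix t u v assume uv: "0 \<le> u" "u < v" "v \<le> 1" "\<bar>u - e\<bar> < \<delta>" "\<bar>v - e\<bar> < \<delta>"
    then obtain w where w: "u < w" "w < v" "f t v - f t u = fu t w * (v - u)"
      using f_mvt by metis
    have "\<bar>fu t w - fu t e\<bar> < \<mu>" using w uv by (intro \<delta>) auto
    then have "fu t w < fu t e + \<mu>" by simp
    then show "f t v - f t u < (fu t e + \<mu>) * (v - u)"
      using w uv(2) by (simp only: w(3) mult_strict_right_mono diff_gt_0_iff_gt)
  qed
qed

end

section \<open>Comparison of subsolutions and supersolutions\<close>

text \<open>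
  The demands of \<open>pulsating_front\<close> apart from the regularity and the equation.
\<close>

definition front_profile :: "real \<Rightarrow> (real \<Rightarrow> real \<Rightarrow> real) \<Rightarrow> bool" where
  "front_profile T U \<longleftrightarrow>
     (\<forall>t x. U t x \<in> {0..1}) \<and>
     uniform_limit UNIV (\<lambda>x t. U t x) (\<lambda>t. 1) at_bot \<and>
     uniform_limit UNIV (\<lambda>x t. U t x) (\<lambda>t. 0) at_top \<and>
     (\<forall>t x. U (t + T) x = U t x)"

text \<open>
  The derivatives are existentially quantified to keep the notion manifestly invariant under
  translations; being unique, they are the classical ones.
\<close>

definition supersolution ::
    "(real \<Rightarrow> real \<Rightarrow> real) \<Rightarrow> real \<Rightarrow> (real \<Rightarrow> real \<Rightarrow> real) \<Rightarrow> bool" where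
  "supersolution f c U \<longleftrightarrow>
     (\<exists>Ut Ux Uxx. parabolic_partials U Ut Ux Uxx \<and>
        (\<forall>t x. f t (U t x) \<le> Ut t x - c * Ux t x - Uxx t x))"

definition subsolution ::
    "(real \<Rightarrow> real \<Rightarrow> real) \<Rightarrow> real \<Rightarrow> (real \<Rightarrow> real \<Rightarrow> real) \<Rightarrow> bool" where
  "subsolution f c U \<longleftrightarrow>
     (\<exists>Ut Ux Uxx. parabolic_partials U Ut Ux Uxx \<and>
        (\<forall>t x. Ut t x - c * Ux t x - Uxx t x \<le> f t (U t x)))"

lemma front_profile_range: "front_profile T U \<Longrightarrow> 0 \<le> U t x" "front_profile T U \<Longrightarrow> U t x \<le> 1"
  by (auto simp: front_profile_def)

lemma front_profile_periodic: "front_profile T U \<Longrightarrow> U (t + T) = U t"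
  by (auto simp: front_profile_def)

lemma front_profile_left:
  assumes "front_profile T U" "0 < \<epsilon>"
  obtains R where "\<And>t x. x \<le> R \<Longrightarrow> 1 - \<epsilon> < U t x"
proof -
  have "\<forall>\<^sub>F x in at_bot. \<forall>t\<in>UNIV. dist (U t x) 1 < \<epsilon>"
    using assms by (intro uniform_limitD) (auto simp: front_profile_def)
  then obtain R where "\<And>t x. x \<le> R \<Longrightarrow> \<bar>U t x - 1\<bar> < \<epsilon>"
    by (auto simp: eventually_at_bot_linorder dist_real_def)
  then show thesis by (intro that[of R]) (smt (verit))
qed

lemma front_profile_right:
  assumes "front_profile T U" "0 < \<epsilon>"
  obtains R where "\<And>t x. R \<le> x \<Longrightarrow> U t x < \<epsilon>"
proof -
  have "\<forall>\<^sub>F x in at_top. \<forall>t\<in>UNIV. dist (U t x) 0 < \<epsilon>"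
    using assms by (intro uniform_limitD) (auto simp: front_profile_def)
  then obtain R where "\<And>t x. R \<le> x \<Longrightarrow> \<bar>U t x\<bar> < \<epsilon>"
    by (auto simp: eventually_at_top_linorder dist_real_def)
  then show thesis by (intro that[of R]) (smt (verit))
qed

lemma front_profile_shift:
  assumes "front_profile T U"
  shows "front_profile T (\<lambda>t x. U t (x - h))"
proof -
  have bot: "LIM x at_bot. x - h :> at_bot" and top: "LIM x at_top. x - h :> at_top"
    by real_asymp+
  have "uniform_limit UNIV (\<lambda>x t. U t (x - h)) (\<lambda>t. 1) at_bot"
    using assms filterlim_compose[OF _ bot] by (auto simp: front_profile_def)
  moreover have "uniform_limit UNIV (\<lambda>x t. U t (x - h)) (\<lambda>t. 0) at_top"
    using assms filterlim_compose[OF _ top] by (auto simp: front_profile_def)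
  ultimately show ?thesis
    using assms by (auto simp: front_profile_def)
qed

lemma supersolution_shift:
  assumes "supersolution f c U"
  shows "supersolution f c (\<lambda>t x. U t (x - h))"
  using assms parabolic_partials_shift unfolding supersolution_def by meson

lemma super_minus_subsolution:
  assumes "supersolution f c U\<^sub>2" and "subsolution f c U\<^sub>1"
  obtains Wt Wx Wxx where "parabolic_partials (\<lambda>t x. U\<^sub>2 t x - U\<^sub>1 t x) Wt Wx Wxx"
    and "\<And>t x. f t (U\<^sub>2 t x) - f t (U\<^sub>1 t x) \<le> Wt t x - c * Wx t x - Wxx t x"
proof -
  from assms(1) obtain Vt Vx Vxx where V: "parabolic_partials U\<^sub>2 Vt Vx Vxx"
      "\<And>t x. f t (U\<^sub>2 t x) \<le> Vt t x - c * Vx t x - Vxx t x"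
    by (auto simp: supersolution_def)
  from assms(2) obtain Ut Ux Uxx where U: "parabolic_partials U\<^sub>1 Ut Ux Uxx"
      "\<And>t x. Ut t x - c * Ux t x - Uxx t x \<le> f t (U\<^sub>1 t x)"
    by (auto simp: subsolution_def)
  show thesis
  proof (rule that[OF parabolic_partials_diff[OF V(1) U(1)]])
    fix t x
    show "f t (U\<^sub>2 t x) - f t (U\<^sub>1 t x)
            \<le> (Vt t x - Ut t x) - c * (Vx t x - Ux t x) - (Vxx t x - Uxx t x)"
      using V(2)[of t x] U(2)[of t x] by (simp add: algebra_simps)
  qed
qed

lemma supersolution_continuous:
  "supersolution f c U \<Longrightarrow> continuous_on UNIV (\<lambda>z. U (fst z) (snd z))"
  by (auto simp: supersolution_def parabolic_partials_def split_beta)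

lemma subsolution_continuous:
  "subsolution f c U \<Longrightarrow> continuous_on UNIV (\<lambda>z. U (fst z) (snd z))"
  by (auto simp: subsolution_def parabolic_partials_def split_beta)

context periodic_reaction
begin

text \<open>
  Wherever the order fails both functions are close to the stable state \<open>e\<close>, so that their difference
  \<open>W = U\<^sub>2 - U\<^sub>1\<close> satisfies the strict inequality of \<open>periodic_comparison\<close> with the zero-mean rate of
  \<open>stable_state_zero_mean_rate\<close>. At infinity \<open>W\<close> cannot be very negative, since both profiles have the
  same limits. The set \<open>S\<close> will be a half-line.
\<close>

lemma half_line_comparison:
  assumes e: "e \<in> {0..1}" and stable: "integral {0..T} (\<lambda>s. fu s e) < 0"
  obtains \<delta> where "0 < \<delta>"
    and "\<And>c U\<^sub>1 U\<^sub>2 S t x. subsolution f c U\<^sub>1 \<Longrightarrow> supersolution f c U\<^sub>2 \<Longrightarrow>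
           front_profile T U\<^sub>1 \<Longrightarrow> front_profile T U\<^sub>2 \<Longrightarrow> closed S \<Longrightarrow>
           (\<And>t x. x \<in> S \<Longrightarrow> x \<notin> interior S \<Longrightarrow> U\<^sub>1 t x \<le> U\<^sub>2 t x) \<Longrightarrow>
           (\<And>t x. x \<in> S \<Longrightarrow> U\<^sub>2 t x < U\<^sub>1 t x \<Longrightarrow> \<bar>U\<^sub>1 t x - e\<bar> < \<delta> \<and> \<bar>U\<^sub>2 t x - e\<bar> < \<delta>) \<Longrightarrow>
           x \<in> S \<Longrightarrow> U\<^sub>1 t x \<le> U\<^sub>2 t x"
proof -
  obtain \<beta> \<delta> where \<beta>: "continuous_on {0..T} \<beta>" "integral {0..T} \<beta> = 0" and "0 < \<delta>"
    and rate: "\<And>t u v. 0 \<le> u \<Longrightarrow> u < v \<Longrightarrow> v \<le> 1 \<Longrightarrow> \<bar>u - e\<bar> < \<delta> \<Longrightarrow> \<bar>v - e\<bar> < \<delta> \<Longrightarrow>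
                 f t v - f t u < \<beta> t * (v - u)"
    using stable_state_zero_mean_rate[OF e stable] by blast
  have "U\<^sub>1 t x \<le> U\<^sub>2 t x"
    if sub: "subsolution f c U\<^sub>1" and sup: "supersolution f c U\<^sub>2"
      and U1: "front_profile T U\<^sub>1" and U2: "front_profile T U\<^sub>2" and "closed S"
      and bdry: "\<And>t x. x \<in> S \<Longrightarrow> x \<notin> interior S \<Longrightarrow> U\<^sub>1 t x \<le> U\<^sub>2 t x"
      and near: "\<And>t x. x \<in> S \<Longrightarrow> U\<^sub>2 t x < U\<^sub>1 t x \<Longrightarrow> \<bar>U\<^sub>1 t x - e\<bar> < \<delta> \<and> \<bar>U\<^sub>2 t x - e\<bar> < \<delta>"
      and "x \<in> S" for c U\<^sub>1 U\<^sub>2 S t x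
  proof -
    note range = front_profile_range[OF U1] front_profile_range[OF U2]
    obtain Wt Wx Wxx where W: "parabolic_partials (\<lambda>t x. U\<^sub>2 t x - U\<^sub>1 t x) Wt Wx Wxx"
      and op: "\<And>t x. f t (U\<^sub>2 t x) - f t (U\<^sub>1 t x) \<le> Wt t x - c * Wx t x - Wxx t x"
      using super_minus_subsolution[OF sup sub] by blast
    have far: "\<exists>R. \<forall>t\<in>{0..T}. \<forall>x\<in>S. R \<le> \<bar>x\<bar> \<longrightarrow> - \<epsilon> < U\<^sub>2 t x - U\<^sub>1 t x"
      if "0 < \<epsilon>" for \<epsilon>
    proof -
      obtain L where L: "\<And>t x. x \<le> L \<Longrightarrow> 1 - \<epsilon> < U\<^sub>2 t x"
        using front_profile_left[OF U2 \<open>0 < \<epsilon>\<close>] by blast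
      obtain R where R: "\<And>t x. R \<le> x \<Longrightarrow> U\<^sub>1 t x < \<epsilon>"
        using front_profile_right[OF U1 \<open>0 < \<epsilon>\<close>] by blast
      have "- \<epsilon> < U\<^sub>2 t x - U\<^sub>1 t x" if "max \<bar>L\<bar> \<bar>R\<bar> \<le> \<bar>x\<bar>" for t x
      proof -
        have "x \<le> L \<or> R \<le> x" using that by linarith
        then show ?thesis
        proof
          assume "x \<le> L"
          from L[OF this, of t] range(2)[of t x] show ?thesis by linarith
        next
          assume "R \<le> x"
          from R[OF this, of t] range(3)[of t x] show ?thesis by linarith
        qed
      qed
      then show ?thesis by blast
    qed
    have ineq: "\<beta> t * (U\<^sub>2 t x - U\<^sub>1 t x) < Wt t x - c * Wx t x - Wxx t x"
      if "x \<in> S" "U\<^sub>2 t x - U\<^sub>1 t x < 0" for t x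
    proof -
      have "f t (U\<^sub>1 t x) - f t (U\<^sub>2 t x) < \<beta> t * (U\<^sub>1 t x - U\<^sub>2 t x)"
        using that near[of x t] range by (intro rate) auto
      then show ?thesis using op[of t x] by (simp add: algebra_simps)
    qed
    obtain s where s: "s \<in> {0..0 + T}" "(U\<^sub>1 s, U\<^sub>2 s) = (U\<^sub>1 t, U\<^sub>2 t)"
      using periodic_representative[of T "\<lambda>t. (U\<^sub>1 t, U\<^sub>2 t)" 0 t] T_pos
        front_profile_periodic[OF U1] front_profile_periodic[OF U2] by metis
    have "0 \<le> U\<^sub>2 s x - U\<^sub>1 s x"
    proof (rule periodic_comparison[OF W T_pos _ \<beta> \<open>closed S\<close> _ far ineq])
      show "U\<^sub>2 T x - U\<^sub>1 T x = U\<^sub>2 0 x - U\<^sub>1 0 x" for x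
        using front_profile_periodic[OF U1, of 0] front_profile_periodic[OF U2, of 0] by simp
      show "0 \<le> U\<^sub>2 t x - U\<^sub>1 t x" if "x \<in> S" "x \<notin> interior S" for t x
        using bdry[OF that] by simp
    qed (use s \<open>x \<in> S\<close> interior_subset in auto)
    then show ?thesis using s(2) by simp
  qed
  with \<open>0 < \<delta>\<close> show thesis by (rule that)
qed

text \<open>
  By periodicity every \<open>(t, x)\<close> may be taken at a time later than \<open>s\<close>, and from the strict inequality
  near \<open>(s, y)\<close> positivity of \<open>U\<^sub>2 - U\<^sub>1\<close> spreads there.
\<close>

lemma strong_comparison:
  assumes sub: "subsolution f c U\<^sub>1" and sup: "supersolution f c U\<^sub>2"
    and U1: "front_profile T U\<^sub>1" and U2: "front_profile T U\<^sub>2"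
    and le: "\<And>t x. U\<^sub>1 t x \<le> U\<^sub>2 t x" and ne: "U\<^sub>1 s y \<noteq> U\<^sub>2 s y"
  shows "U\<^sub>1 t x < U\<^sub>2 t x"
proof -
  obtain Wt Wx Wxx where W: "parabolic_partials (\<lambda>t x. U\<^sub>2 t x - U\<^sub>1 t x) Wt Wx Wxx"
    and op: "\<And>t x. f t (U\<^sub>2 t x) - f t (U\<^sub>1 t x) \<le> Wt t x - c * Wx t x - Wxx t x"
    using super_minus_subsolution[OF sup sub] by blast
  obtain K where "0 \<le> K"
    and K: "\<And>t u v. 0 \<le> u \<Longrightarrow> u \<le> v \<Longrightarrow> v \<le> 1 \<Longrightarrow> - K * (v - u) \<le> f t v - f t u"
    using f_lower_lipschitz by blast
  define m where "m = U\<^sub>2 s y - U\<^sub>1 s y"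
  have "0 < m" using le[of s y] ne by (simp add: m_def)
  have "isCont (\<lambda>x. U\<^sub>2 s x - U\<^sub>1 s x) y"
    using W DERIV_isCont by (fastforce simp: parabolic_partials_def)
  then obtain d where "0 < d"
    and d: "\<And>x. \<bar>x - y\<bar> < d \<Longrightarrow> \<bar>(U\<^sub>2 s x - U\<^sub>1 s x) - m\<bar> < m / 2"
    unfolding continuous_at_eps_delta m_def dist_real_def
    using \<open>0 < m\<close> by (metis half_gt_zero m_def)
  obtain t' where t': "t' \<in> {s + 1..s + 1 + T}" "(U\<^sub>1 t', U\<^sub>2 t') = (U\<^sub>1 t, U\<^sub>2 t)"
    using periodic_representative[of T "\<lambda>t. (U\<^sub>1 t, U\<^sub>2 t)" "s + 1" t] T_pos
      front_profile_periodic[OF U1] front_profile_periodic[OF U2] by metis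
  have "s < t'" "0 < d / 2" using t' \<open>0 < d\<close> by auto
  obtain \<kappa> where "0 < \<kappa>"
    and \<kappa>: "\<And>W Wt Wx Wxx \<epsilon>. parabolic_partials W Wt Wx Wxx \<Longrightarrow> (\<And>t x. 0 \<le> W t x) \<Longrightarrow>
           (\<And>t x. - K * W t x \<le> Wt t x - c * Wx t x - Wxx t x) \<Longrightarrow>
           0 < \<epsilon> \<Longrightarrow> (\<And>x. \<bar>x - y\<bar> \<le> d / 2 \<Longrightarrow> \<epsilon> \<le> W s x) \<Longrightarrow> \<kappa> * \<epsilon> \<le> W t' x"
    using positivity_spreads[OF \<open>0 \<le> K\<close> \<open>0 < d / 2\<close> \<open>s < t'\<close>] by blast
  have "\<kappa> * (m / 2) \<le> U\<^sub>2 t' x - U\<^sub>1 t' x"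
  proof (rule \<kappa>[OF W])
    show "0 \<le> U\<^sub>2 t x - U\<^sub>1 t x" for t x using le[of t x] by simp
    show "- K * (U\<^sub>2 t x - U\<^sub>1 t x) \<le> Wt t x - c * Wx t x - Wxx t x" for t x
      using K[OF _ le, of t x t] front_profile_range[OF U1] front_profile_range[OF U2] op[of t x]
      by fastforce
    show "0 < m / 2" using \<open>0 < m\<close> by simp
    show "m / 2 \<le> U\<^sub>2 s x - U\<^sub>1 s x" if "\<bar>x - y\<bar> \<le> d / 2" for x
      using d[of x] that \<open>0 < d\<close> by linarith
  qed
  moreover have "0 < \<kappa> * (m / 2)" using \<open>0 < \<kappa>\<close> \<open>0 < m\<close> by simp
  ultimately show ?thesis using t'(2) by simp
qed

end

locale bistable_reaction = periodic_reaction +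
  assumes stable_0: "integral {0..T} (\<lambda>s. fu s 0) < 0"
    and stable_1: "integral {0..T} (\<lambda>s. fu s 1) < 0"
begin

text \<open>
  On \<open>[b, \<infinity>)\<close> a point with \<open>U\<^sub>2 < U\<^sub>1\<close> has both values below \<open>\<delta>\<close>, on \<open>(-\<infinity>, a]\<close> both values above
  \<open>1 - \<delta>\<close>. So the order on the middle interval extends to the two half-lines by
  \<open>half_line_comparison\<close> at the stable states \<open>0\<close> and \<open>1\<close>.
\<close>

lemma comparison_from_middle:
  obtains \<delta> where "0 < \<delta>" and "\<delta> \<le> 1 / 2"
    and "\<And>c U\<^sub>1 U\<^sub>2 a b t x. subsolution f c U\<^sub>1 \<Longrightarrow> supersolution f c U\<^sub>2 \<Longrightarrow>
           front_profile T U\<^sub>1 \<Longrightarrow> front_profile T U\<^sub>2 \<Longrightarrow> a \<le> b \<Longrightarrow>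
           (\<And>t x. b \<le> x \<Longrightarrow> U\<^sub>1 t x < \<delta>) \<Longrightarrow> (\<And>t x. x \<le> a \<Longrightarrow> 1 - \<delta> < U\<^sub>2 t x) \<Longrightarrow>
           (\<And>t x. a \<le> x \<Longrightarrow> x \<le> b \<Longrightarrow> U\<^sub>1 t x \<le> U\<^sub>2 t x) \<Longrightarrow> U\<^sub>1 t x \<le> U\<^sub>2 t x"
proof -
  have e0: "0 \<in> {0..1::real}" and e1: "1 \<in> {0..1::real}" by simp_all
  obtain \<delta>0 where "0 < \<delta>0" and right:
    "\<And>c U\<^sub>1 U\<^sub>2 S t x. subsolution f c U\<^sub>1 \<Longrightarrow> supersolution f c U\<^sub>2 \<Longrightarrow>
       front_profile T U\<^sub>1 \<Longrightarrow> front_profile T U\<^sub>2 \<Longrightarrow> closed S \<Longrightarrow>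
       (\<And>t x. x \<in> S \<Longrightarrow> x \<notin> interior S \<Longrightarrow> U\<^sub>1 t x \<le> U\<^sub>2 t x) \<Longrightarrow>
       (\<And>t x. x \<in> S \<Longrightarrow> U\<^sub>2 t x < U\<^sub>1 t x \<Longrightarrow> \<bar>U\<^sub>1 t x - 0\<bar> < \<delta>0 \<and> \<bar>U\<^sub>2 t x - 0\<bar> < \<delta>0) \<Longrightarrow>
       x \<in> S \<Longrightarrow> U\<^sub>1 t x \<le> U\<^sub>2 t x"
    using half_line_comparison[OF e0 stable_0] by blast
  obtain \<delta>1 where "0 < \<delta>1" and left:
    "\<And>c U\<^sub>1 U\<^sub>2 S t x. subsolution f c U\<^sub>1 \<Longrightarrow> supersolution f c U\<^sub>2 \<Longrightarrow>
       front_profile T U\<^sub>1 \<Longrightarrow> front_profile T U\<^sub>2 \<Longrightarrow> closed S \<Longrightarrow>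
       (\<And>t x. x \<in> S \<Longrightarrow> x \<notin> interior S \<Longrightarrow> U\<^sub>1 t x \<le> U\<^sub>2 t x) \<Longrightarrow>
       (\<And>t x. x \<in> S \<Longrightarrow> U\<^sub>2 t x < U\<^sub>1 t x \<Longrightarrow> \<bar>U\<^sub>1 t x - 1\<bar> < \<delta>1 \<and> \<bar>U\<^sub>2 t x - 1\<bar> < \<delta>1) \<Longrightarrow>
       x \<in> S \<Longrightarrow> U\<^sub>1 t x \<le> U\<^sub>2 t x"
    using half_line_comparison[OF e1 stable_1] by blast
  define \<delta> where "\<delta> = min (1 / 2) (min \<delta>0 \<delta>1)"
  show thesis
  proof (rule that[of \<delta>])
    show "0 < \<delta>" "\<delta> \<le> 1 / 2" using \<open>0 < \<delta>0\<close> \<open>0 < \<delta>1\<close> by (auto simp: \<delta>_def)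
    fix c U\<^sub>1 U\<^sub>2 a b t x
    assume hyps: "subsolution f c U\<^sub>1" "supersolution f c U\<^sub>2"
        "front_profile T U\<^sub>1" "front_profile T U\<^sub>2"
      and "a \<le> b" and small: "\<And>t x. b \<le> x \<Longrightarrow> U\<^sub>1 t x < \<delta>"
      and large: "\<And>t x. x \<le> a \<Longrightarrow> 1 - \<delta> < U\<^sub>2 t x"
      and mid: "\<And>t x. a \<le> x \<Longrightarrow> x \<le> b \<Longrightarrow> U\<^sub>1 t x \<le> U\<^sub>2 t x"
    note range = front_profile_range[OF hyps(3)] front_profile_range[OF hyps(4)]
    consider "b \<le> x" | "x \<le> a" | "a \<le> x" "x \<le> b" by linarith
    then show "U\<^sub>1 t x \<le> U\<^sub>2 t x"
    proof cases
      case 1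
      show ?thesis
      proof (rule right[OF hyps, of "{b..}"])
        show "U\<^sub>1 t x \<le> U\<^sub>2 t x" if "x \<in> {b..}" "x \<notin> interior {b..}" for t x
          using that \<open>a \<le> b\<close> by (auto intro: mid)
        show "\<bar>U\<^sub>1 t x - 0\<bar> < \<delta>0 \<and> \<bar>U\<^sub>2 t x - 0\<bar> < \<delta>0"
          if "x \<in> {b..}" "U\<^sub>2 t x < U\<^sub>1 t x" for t x
          using that small[of x t] range(1,3)[of t x] by (auto simp: \<delta>_def)
      qed (use 1 in auto)
    next
      case 2
      show ?thesis
      proof (rule left[OF hyps, of "{..a}"])
        show "U\<^sub>1 t x \<le> U\<^sub>2 t x" if "x \<in> {..a}" "x \<notin> interior {..a}" for t x
          using that \<open>a \<le> b\<close> by (auto intro: mid)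
        show "\<bar>U\<^sub>1 t x - 1\<bar> < \<delta>1 \<and> \<bar>U\<^sub>2 t x - 1\<bar> < \<delta>1"
          if "x \<in> {..a}" "U\<^sub>2 t x < U\<^sub>1 t x" for t x
          using that large[of x t] range(2,4)[of t x] by (auto simp: \<delta>_def)
      qed (use 2 in auto)
    next
      case 3
      then show ?thesis by (rule mid)
    qed
  qed
qed

text \<open>
  Two ordered profiles that do not coincide are strictly ordered, with a positive gap on a compact
  middle region, and uniform continuity leaves room there for a slightly smaller shift. Outside
  the middle region \<open>comparison_from_middle\<close> restores the order.
\<close>

lemma slide_back:
  assumes sub: "subsolution f c U\<^sub>1" and sup: "supersolution f c U\<^sub>2"
    and U1: "front_profile T U\<^sub>1" and U2: "front_profile T U\<^sub>2"
    and le: "\<And>t x. U\<^sub>1 t x \<le> U\<^sub>2 t (x - \<tau>)" and ne: "U\<^sub>1 s y \<noteq> U\<^sub>2 s (y - \<tau>)"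
  obtains \<epsilon> where "0 < \<epsilon>"
    and "\<And>\<sigma> t x. \<tau> - \<epsilon> \<le> \<sigma> \<Longrightarrow> \<sigma> \<le> \<tau> \<Longrightarrow> U\<^sub>1 t x \<le> U\<^sub>2 t (x - \<sigma>)"
proof -
  have less: "U\<^sub>1 t x < U\<^sub>2 t (x - \<tau>)" for t x
    by (rule strong_comparison[OF sub supersolution_shift[OF sup] U1 front_profile_shift[OF U2] le ne])
  obtain \<delta> where \<delta>: "0 < \<delta>" "\<delta> \<le> 1 / 2"
    and middle: "\<And>c U\<^sub>1 U\<^sub>2 a b t x. subsolution f c U\<^sub>1 \<Longrightarrow> supersolution f c U\<^sub>2 \<Longrightarrow>
           front_profile T U\<^sub>1 \<Longrightarrow> front_profile T U\<^sub>2 \<Longrightarrow> a \<le> b \<Longrightarrow>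
           (\<And>t x. b \<le> x \<Longrightarrow> U\<^sub>1 t x < \<delta>) \<Longrightarrow> (\<And>t x. x \<le> a \<Longrightarrow> 1 - \<delta> < U\<^sub>2 t x) \<Longrightarrow>
           (\<And>t x. a \<le> x \<Longrightarrow> x \<le> b \<Longrightarrow> U\<^sub>1 t x \<le> U\<^sub>2 t x) \<Longrightarrow> U\<^sub>1 t x \<le> U\<^sub>2 t x"
    using comparison_from_middle by blast
  obtain b where b: "\<And>t x. b \<le> x \<Longrightarrow> U\<^sub>1 t x < \<delta>"
    using front_profile_right[OF U1 \<delta>(1)] by blast
  obtain L where L: "\<And>t x. x \<le> L \<Longrightarrow> 1 - \<delta> < U\<^sub>2 t x"
    using front_profile_left[OF U2 \<delta>(1)] by blast
  \<comment> \<open>With this \<open>a\<close>, the translates of \<open>U\<^sub>2\<close> by any \<open>\<sigma> \<in> [\<tau> - 1, \<tau>]\<close> exceed \<open>1 - \<delta>\<close> to the left of \<open>a\<close>.\<close>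
  define a where "a = min b (L + \<tau> - 1)"
  define Q where "Q = {0..T} \<times> {a..b}"
  have cont1: "continuous_on UNIV (\<lambda>z. U\<^sub>1 (fst z) (snd z))"
    by (rule subsolution_continuous[OF sub])
  have cont2: "continuous_on UNIV (\<lambda>z. U\<^sub>2 (fst z) (snd z))"
    by (rule supersolution_continuous[OF sup])
  have "compact Q" "Q \<noteq> {}"
    using T_pos by (auto simp: Q_def a_def intro!: compact_Times)
  moreover have "continuous_on Q (\<lambda>z. U\<^sub>2 (fst z) (snd z - \<tau>) - U\<^sub>1 (fst z) (snd z))"
    using supersolution_continuous[OF supersolution_shift[OF sup]] cont1
    by (intro continuous_on_diff) (auto intro: continuous_on_subset)
  ultimately obtain z where z: "z \<in> Q"
    "\<And>z'. z' \<in> Q \<Longrightarrow> U\<^sub>2 (fst z) (snd z - \<tau>) - U\<^sub>1 (fst z) (snd z)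
                      \<le> U\<^sub>2 (fst z') (snd z' - \<tau>) - U\<^sub>1 (fst z') (snd z')"
    using continuous_attains_inf[of Q "\<lambda>z. U\<^sub>2 (fst z) (snd z - \<tau>) - U\<^sub>1 (fst z) (snd z)"] by blast
  define m where "m = U\<^sub>2 (fst z) (snd z - \<tau>) - U\<^sub>1 (fst z) (snd z)"
  have "0 < m" using less by (simp add: m_def)
  have gap: "m \<le> U\<^sub>2 t (x - \<tau>) - U\<^sub>1 t x" if "t \<in> {0..T}" "x \<in> {a..b}" for t x
    using z(2)[of "(t, x)"] that by (simp add: m_def Q_def)
  have "uniformly_continuous_on ({0..T} \<times> {a - \<tau>..b - \<tau> + 1}) (\<lambda>z. U\<^sub>2 (fst z) (snd z))"
    by (intro compact_uniformly_continuous compact_Times compact_Icc continuous_on_subset[OF cont2]) auto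
  then obtain d where "0 < d" and d:
    "\<And>z z'. z \<in> {0..T} \<times> {a - \<tau>..b - \<tau> + 1} \<Longrightarrow> z' \<in> {0..T} \<times> {a - \<tau>..b - \<tau> + 1} \<Longrightarrow>
       dist z' z < d \<Longrightarrow> dist (U\<^sub>2 (fst z') (snd z')) (U\<^sub>2 (fst z) (snd z)) < m"
    unfolding uniformly_continuous_on_def using \<open>0 < m\<close> by meson
  define \<epsilon> where "\<epsilon> = min 1 (d / 2)"
  show thesis
  proof (rule that[of \<epsilon>])
    show "0 < \<epsilon>" using \<open>0 < d\<close> by (simp add: \<epsilon>_def)
    fix \<sigma> t x assume \<sigma>: "\<tau> - \<epsilon> \<le> \<sigma>" "\<sigma> \<le> \<tau>"
    then have \<sigma>1: "\<tau> - 1 \<le> \<sigma>" "\<tau> - \<sigma> < d" using \<open>0 < d\<close> by (auto simp: \<epsilon>_def)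
    show "U\<^sub>1 t x \<le> U\<^sub>2 t (x - \<sigma>)"
    proof (rule middle[OF sub supersolution_shift[OF sup] U1 front_profile_shift[OF U2] _ b, of a])
      show "a \<le> b" by (simp add: a_def)
      show "1 - \<delta> < U\<^sub>2 t (x - \<sigma>)" if "x \<le> a" for t x
        using that \<sigma>1 by (intro L) (auto simp: a_def)
      show "U\<^sub>1 t x \<le> U\<^sub>2 t (x - \<sigma>)" if x: "a \<le> x" "x \<le> b" for t x
      proof -
        obtain s where s: "s \<in> {0..0 + T}" "(U\<^sub>1 s, U\<^sub>2 s) = (U\<^sub>1 t, U\<^sub>2 t)"
          using periodic_representative[of T "\<lambda>t. (U\<^sub>1 t, U\<^sub>2 t)" 0 t] T_pos
            front_profile_periodic[OF U1] front_profile_periodic[OF U2] by metis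
        have "dist (s, x - \<sigma>) (s, x - \<tau>) < d"
          using \<sigma> \<sigma>1 by (simp add: dist_Pair_Pair dist_real_def)
        then have "dist (U\<^sub>2 s (x - \<sigma>)) (U\<^sub>2 s (x - \<tau>)) < m"
          using d[of "(s, x - \<tau>)" "(s, x - \<sigma>)"] s(1) x \<sigma> \<sigma>1 by simp
        moreover have "m \<le> U\<^sub>2 s (x - \<tau>) - U\<^sub>1 s x" using s x by (intro gap) auto
        ultimately have "U\<^sub>1 s x \<le> U\<^sub>2 s (x - \<sigma>)" by (auto simp: dist_real_def)
        then show ?thesis using s(2) by simp
      qed
    qed
  qed
qed

text \<open>
  The sliding argument. The shifts \<open>\<tau> \<ge> \<tau>0\<close> for which \<open>U\<^sub>2\<close>, translated by \<open>\<tau>\<close>, lies above \<open>U\<^sub>1\<close> form a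
  closed set \<open>G\<close>. It is nonempty: after a large shift \<open>U\<^sub>2\<close> is still close to \<open>1\<close> where \<open>U\<^sub>1\<close> is
  already close to \<open>0\<close>. Its infimum differs from \<open>\<tau>0\<close>, and if the two functions did not coincide
  there, \<open>slide_back\<close> would lead to smaller elements.
\<close>

lemma critical_shift_coincides:
  assumes sub: "subsolution f c U\<^sub>1" and sup: "supersolution f c U\<^sub>2"
    and U1: "front_profile T U\<^sub>1" and U2: "front_profile T U\<^sub>2"
    and not_le: "\<not> U\<^sub>1 t0 x0 \<le> U\<^sub>2 t0 (x0 - \<tau>0)"
  obtains \<tau> where "\<tau>0 < \<tau>" and "\<And>t x. U\<^sub>1 t x = U\<^sub>2 t (x - \<tau>)"
proof -
  define G where "G = {\<tau>. \<tau>0 \<le> \<tau> \<and> (\<forall>t x. U\<^sub>1 t x \<le> U\<^sub>2 t (x - \<tau>))}"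
  have "G \<noteq> {}"
  proof -
    obtain \<delta> where \<delta>: "0 < \<delta>" "\<delta> \<le> 1 / 2"
      and middle: "\<And>c U\<^sub>1 U\<^sub>2 a b t x. subsolution f c U\<^sub>1 \<Longrightarrow> supersolution f c U\<^sub>2 \<Longrightarrow>
             front_profile T U\<^sub>1 \<Longrightarrow> front_profile T U\<^sub>2 \<Longrightarrow> a \<le> b \<Longrightarrow>
             (\<And>t x. b \<le> x \<Longrightarrow> U\<^sub>1 t x < \<delta>) \<Longrightarrow> (\<And>t x. x \<le> a \<Longrightarrow> 1 - \<delta> < U\<^sub>2 t x) \<Longrightarrow>
             (\<And>t x. a \<le> x \<Longrightarrow> x \<le> b \<Longrightarrow> U\<^sub>1 t x \<le> U\<^sub>2 t x) \<Longrightarrow> U\<^sub>1 t x \<le> U\<^sub>2 t x"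
      using comparison_from_middle by blast
    obtain b where b: "\<And>t x. b \<le> x \<Longrightarrow> U\<^sub>1 t x < \<delta>"
      using front_profile_right[OF U1 \<delta>(1)] by blast
    obtain L where L: "\<And>t x. x \<le> L \<Longrightarrow> 1 - \<delta> < U\<^sub>2 t x"
      using front_profile_left[OF U2 \<delta>(1)] by blast
    define \<tau> where "\<tau> = max \<tau>0 (b - L)"
    \<comment> \<open>The middle interval is the single point \<open>b\<close>, where \<open>U\<^sub>1 < \<delta> \<le> 1 - \<delta> < U\<^sub>2\<close> after the shift.\<close>
    have large: "1 - \<delta> < U\<^sub>2 t (x - \<tau>)" if "x \<le> b" for t x
      using that by (intro L) (auto simp: \<tau>_def)
    have "U\<^sub>1 t x \<le> U\<^sub>2 t (x - \<tau>)" for t x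
    proof (rule middle[OF sub supersolution_shift[OF sup] U1 front_profile_shift[OF U2]
            order_refl b large])
      show "U\<^sub>1 t x \<le> U\<^sub>2 t (x - \<tau>)" if "b \<le> x" "x \<le> b" for t x
        using b[OF that(1), of t] large[OF that(2), of t] \<delta>(2) by linarith
    qed
    then have "\<tau> \<in> G" by (simp add: G_def \<tau>_def)
    then show ?thesis by blast
  qed
  have bdd: "bdd_below G" by (auto simp: G_def intro!: bdd_belowI)
  have "closed G"
  proof -
    have "continuous_on UNIV (\<lambda>\<tau>. U\<^sub>2 t (x - \<tau>))" for t x
    proof -
      have "continuous_on UNIV (\<lambda>\<tau>. (t, x - \<tau>))" by (intro continuous_intros)
      from continuous_on_compose2[OF supersolution_continuous[OF sup] this] show ?thesis by simp
    qed
    then show ?thesis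
      unfolding G_def
      by (intro closed_Collect_conj closed_Collect_all closed_Collect_le continuous_intros) 
  qed
  define \<tau> where "\<tau> = Inf G"
  have \<tau>: "\<tau> \<in> G"
    unfolding \<tau>_def by (rule closed_contains_Inf) fact+
  then have le: "\<And>t x. U\<^sub>1 t x \<le> U\<^sub>2 t (x - \<tau>)" and "\<tau>0 \<le> \<tau>" by (auto simp: G_def)
  then have "\<tau>0 < \<tau>" using not_le by (metis order_le_less)
  moreover have "U\<^sub>1 t x = U\<^sub>2 t (x - \<tau>)" for t x
  proof (rule ccontr)
    assume "U\<^sub>1 t x \<noteq> U\<^sub>2 t (x - \<tau>)"
    then obtain \<epsilon> where "0 < \<epsilon>"
      and \<epsilon>: "\<And>\<sigma> t x. \<tau> - \<epsilon> \<le> \<sigma> \<Longrightarrow> \<sigma> \<le> \<tau> \<Longrightarrow> U\<^sub>1 t x \<le> U\<^sub>2 t (x - \<sigma>)"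
      using slide_back[OF sub sup U1 U2 le] by blast
    have "max \<tau>0 (\<tau> - \<epsilon>) \<in> G"
      using \<epsilon> \<open>0 < \<epsilon>\<close> \<open>\<tau>0 \<le> \<tau>\<close> by (simp add: G_def)
    then have "\<tau> \<le> max \<tau>0 (\<tau> - \<epsilon>)"
      unfolding \<tau>_def using bdd by (rule cInf_lower)
    then show False using \<open>\<tau>0 < \<tau>\<close> \<open>0 < \<epsilon>\<close> by simp
  qed
  ultimately show thesis by (rule that)
qed

end

section \<open>Monotonicity and uniqueness of pulsating fronts\<close>

lemma pulsating_front_profile: "pulsating_front T f c U \<Longrightarrow> front_profile T U"
  by (simp add: pulsating_front_def front_profile_def)

lemma pulsating_front_partials:
  "pulsating_front T f c U \<Longrightarrow>
     parabolic_partials U (partial_t U) (partial_xi U) (partial_xi (partial_xi U))"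
  by (simp add: pulsating_front_def C_1_2_parabolic_partials)

lemma pulsating_front_equation:
  "pulsating_front T f c U \<Longrightarrow>
     partial_t U t x - c * partial_xi U t x - partial_xi (partial_xi U) t x = f t (U t x)"
  by (simp add: pulsating_front_def)

lemma pulsating_front_subsolution: "pulsating_front T f c U \<Longrightarrow> subsolution f c U"
  unfolding subsolution_def
  using pulsating_front_partials pulsating_front_equation by (metis order_refl)

lemma pulsating_front_supersolution: "pulsating_front T f c U \<Longrightarrow> supersolution f c U"
  unfolding supersolution_def
  using pulsating_front_partials pulsating_front_equation by (metis order_refl)

context bistable_reaction
begin

text \<open>
  The front is compared with its own translates. A shift \<open>h > 0\<close> that violates the order would give
  a coincidence at some shift \<open>\<tau> > h\<close>, and \<open>U 0\<close> would have the period \<open>\<tau>\<close> in space, which is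
  incompatible with the different limits at the two ends.
\<close>

lemma pulsating_front_antimono:
  assumes U: "pulsating_front T f c U" and "0 < h"
  shows "U t x \<le> U t (x - h)"
proof (rule ccontr)
  note profile = pulsating_front_profile[OF U]
  assume "\<not> U t x \<le> U t (x - h)"
  then obtain \<tau> where "h < \<tau>" and \<tau>: "\<And>t x. U t x = U t (x - \<tau>)"
    using critical_shift_coincides[OF pulsating_front_subsolution[OF U]
        pulsating_front_supersolution[OF U] profile profile] by blast
  obtain L where L: "\<And>t x. x \<le> L \<Longrightarrow> 1 - 1 / 2 < U t x"
    using front_profile_left[OF profile, of "1 / 2"] by auto
  obtain R where R: "\<And>t x. R \<le> x \<Longrightarrow> U t x < 1 / 2"
    using front_profile_right[OF profile, of "1 / 2"] by auto
  have "U 0 (x + \<tau>) = U 0 x" for x using \<tau>[of 0 "x + \<tau>"] by simp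
  moreover have "0 < \<tau>" using \<open>0 < h\<close> \<open>h < \<tau>\<close> by simp
  ultimately obtain z where "z \<in> {R..R + \<tau>}" "U 0 z = U 0 L"
    using periodic_representative[of \<tau> "U 0" R L] by blast
  then show False using L[of L 0] R[of z 0] by simp
qed

text \<open>
  The function \<open>U\<^sub>\<xi>\<close> solves the linearised equation only formally, because its time derivative need not
  exist. Instead \<open>positivity_spreads\<close> is applied to \<open>U (x - h) - U x \<ge> 0\<close>. Some time earlier \<open>U\<close> has a
  negative slope at some place \<open>y\<close>, so this difference is at least \<open>m * h\<close> near \<open>y\<close>; hence it is at
  least \<open>\<kappa> * m * h\<close> at \<open>(t, x)\<close> with \<open>\<kappa>\<close> independent of \<open>h\<close>, and \<open>U\<^sub>\<xi> \<le> - \<kappa> * m\<close> follows as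
  \<open>h\<close> tends to \<open>0\<close>.
\<close>

lemma pulsating_front_strictly_decreasing:
  assumes U: "pulsating_front T f c U"
  shows "partial_xi U t x < 0"
proof -
  note profile = pulsating_front_profile[OF U]
  note partials = pulsating_front_partials[OF U]
  have dx: "(U t has_real_derivative partial_xi U t x) (at x)" for t x
    using partials by (simp add: parabolic_partials_def)
  have dxx: "(partial_xi U t has_real_derivative partial_xi (partial_xi U) t x) (at x)" for t x
    using partials by (simp add: parabolic_partials_def)
  define s where "s = t - 1"
  have "s < t" by (simp add: s_def)
  obtain y where "partial_xi U s y < 0"
  proof (rule ccontr)
    assume "\<not> thesis"
    then have nonneg: "0 \<le> partial_xi U s y" for y using that by (meson not_le)
    obtain L where L: "\<And>t x. x \<le> L \<Longrightarrow> 1 - 1 / 2 < U t x"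
      using front_profile_left[OF profile, of "1 / 2"] by auto
    obtain R where R: "\<And>t x. R \<le> x \<Longrightarrow> U t x < 1 / 2"
      using front_profile_right[OF profile, of "1 / 2"] by auto
    have "U s (min L R) \<le> U s R"
    proof (rule DERIV_nonneg_imp_nondecreasing[of "min L R" R "U s"])
      show "\<exists>D. (U s has_real_derivative D) (at z) \<and> 0 \<le> D" for z
        using dx[of s z] nonneg[of z] by blast
    qed simp
    then show False using L[of "min L R" s] R[of R s] by simp
  qed
  define m where "m = - partial_xi U s y / 2"
  have "0 < m" using \<open>partial_xi U s y < 0\<close> by (simp add: m_def)
  have "isCont (partial_xi U s) y"
    by (rule DERIV_isCont[OF dxx])
  then obtain d where "0 < d"
    and d: "\<And>z. \<bar>z - y\<bar> < d \<Longrightarrow> \<bar>partial_xi U s z - partial_xi U s y\<bar> < m"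
    unfolding continuous_at_eps_delta dist_real_def using \<open>0 < m\<close> by metis
  have slope: "partial_xi U s z < - m" if "\<bar>z - y\<bar> < d" for z
    using d[OF that] unfolding m_def by linarith
  obtain K where "0 \<le> K"
    and K: "\<And>t u v. 0 \<le> u \<Longrightarrow> u \<le> v \<Longrightarrow> v \<le> 1 \<Longrightarrow> - K * (v - u) \<le> f t v - f t u"
    using f_lower_lipschitz by blast
  have "0 < d / 2" using \<open>0 < d\<close> by simp
  obtain \<kappa> where "0 < \<kappa>"
    and \<kappa>: "\<And>W Wt Wx Wxx \<epsilon>. parabolic_partials W Wt Wx Wxx \<Longrightarrow> (\<And>t x. 0 \<le> W t x) \<Longrightarrow>
           (\<And>t x. - K * W t x \<le> Wt t x - c * Wx t x - Wxx t x) \<Longrightarrow>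
           0 < \<epsilon> \<Longrightarrow> (\<And>x. \<bar>x - y\<bar> \<le> d / 2 \<Longrightarrow> \<epsilon> \<le> W s x) \<Longrightarrow> \<kappa> * \<epsilon> \<le> W t x"
    using positivity_spreads[OF \<open>0 \<le> K\<close> \<open>0 < d / 2\<close> \<open>s < t\<close>] by blast
  have drop: "\<kappa> * (m * h) \<le> U t (x - h) - U t x" if h: "0 < h" "h < d / 2" for h
  proof -
    have le: "U t x \<le> U t (x - h)" for t x
      by (rule pulsating_front_antimono[OF U h(1)])
    show ?thesis
    proof (rule \<kappa>[OF parabolic_partials_diff[OF parabolic_partials_shift[OF partials] partials]])
      show "0 \<le> U t (x - h) - U t x" for t x using le[of t x] by simp
      show "- K * (U t (x - h) - U t x)
              \<le> (partial_t U t (x - h) - partial_t U t x)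
                - c * (partial_xi U t (x - h) - partial_xi U t x)
                - (partial_xi (partial_xi U) t (x - h) - partial_xi (partial_xi U) t x)" for t x
        using K[OF front_profile_range(1)[OF profile] le front_profile_range(2)[OF profile], of t x t]
          pulsating_front_equation[OF U, of t x] pulsating_front_equation[OF U, of t "x - h"]
        by (simp add: algebra_simps)
      show "0 < m * h" using \<open>0 < m\<close> h by simp
      show "m * h \<le> U s (z - h) - U s z" if "\<bar>z - y\<bar> \<le> d / 2" for z
      proof -
        obtain w where w: "z - h < w" "w < z" "U s z - U s (z - h) = (z - (z - h)) * partial_xi U s w"
          using MVT2[of "z - h" z "U s" "partial_xi U s"] dx h by auto
        have "partial_xi U s w < - m" using w h that by (intro slope) linarith
        then have "h * partial_xi U s w \<le> h * (- m)" using h by (intro mult_left_mono) auto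
        then show ?thesis using w(3) by (simp add: mult.commute)
      qed
    qed
  qed
  have "\<not> 0 < partial_xi U t x + \<kappa> * m"
  proof
    assume pos: "0 < partial_xi U t x + \<kappa> * m"
    have "((\<lambda>x. U t x + \<kappa> * m * x) has_real_derivative partial_xi U t x + \<kappa> * m) (at x)"
      by (auto intro!: derivative_eq_intros dx)
    from DERIV_pos_inc_left[OF this pos] obtain e where "0 < e"
      and e: "\<And>h. 0 < h \<Longrightarrow> h < e \<Longrightarrow> U t (x - h) + \<kappa> * m * (x - h) < U t x + \<kappa> * m * x"
      by blast
    define h where "h = min e (d / 2) / 2"
    have "0 < h" "h < e" "h < d / 2" using \<open>0 < e\<close> \<open>0 < d\<close> by (auto simp: h_def)
    then show False using drop[of h] e[of h] by (simp add: algebra_simps)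
  qed
  moreover have "0 < \<kappa> * m" using \<open>0 < \<kappa>\<close> \<open>0 < m\<close> by simp
  ultimately show ?thesis by linarith
qed

text \<open>
  As \<open>U\<^sub>2\<close> decreases in space, replacing its speed by \<open>c\<^sub>1 \<ge> c\<^sub>2\<close> adds the nonnegative term
  \<open>(c\<^sub>2 - c\<^sub>1) * U\<^sub>2\<^sub>,\<^sub>\<xi>\<close> to the left-hand side, so \<open>U\<^sub>2\<close> is a supersolution for the speed \<open>c\<^sub>1\<close> and some
  translate of it coincides with \<open>U\<^sub>1\<close>. The two equations then differ by that term alone; it vanishes,
  and \<open>c\<^sub>1 = c\<^sub>2\<close> because the slope does not.
\<close>

lemma pulsating_front_unique_ordered_speeds:
  assumes U1: "pulsating_front T f c\<^sub>1 U\<^sub>1" and U2: "pulsating_front T f c\<^sub>2 U\<^sub>2" and "c\<^sub>2 \<le> c\<^sub>1"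
  obtains \<tau> where "c\<^sub>1 = c\<^sub>2" and "\<And>t x. U\<^sub>1 t x = U\<^sub>2 t (x - \<tau>)"
proof -
  note profile1 = pulsating_front_profile[OF U1]
  note profile2 = pulsating_front_profile[OF U2]
  have sup: "supersolution f c\<^sub>1 U\<^sub>2"
    unfolding supersolution_def
  proof (intro exI conjI allI)
    show "parabolic_partials U\<^sub>2 (partial_t U\<^sub>2) (partial_xi U\<^sub>2) (partial_xi (partial_xi U\<^sub>2))"
      by (rule pulsating_front_partials[OF U2])
    fix t x
    have "c\<^sub>1 * partial_xi U\<^sub>2 t x \<le> c\<^sub>2 * partial_xi U\<^sub>2 t x"
      using \<open>c\<^sub>2 \<le> c\<^sub>1\<close> pulsating_front_strictly_decreasing[OF U2, of t x]
      by (intro mult_right_mono_neg) auto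
    then show "f t (U\<^sub>2 t x)
        \<le> partial_t U\<^sub>2 t x - c\<^sub>1 * partial_xi U\<^sub>2 t x - partial_xi (partial_xi U\<^sub>2) t x"
      using pulsating_front_equation[OF U2, of t x] by linarith
  qed
  obtain L where L: "\<And>t x. x \<le> L \<Longrightarrow> 1 - 1 / 2 < U\<^sub>1 t x"
    using front_profile_left[OF profile1, of "1 / 2"] by auto
  obtain R where R: "\<And>t x. R \<le> x \<Longrightarrow> U\<^sub>2 t x < 1 / 2"
    using front_profile_right[OF profile2, of "1 / 2"] by auto
  \<comment> \<open>The shift \<open>L - R\<close> is too small: it moves the lower half of \<open>U\<^sub>2\<close> to where \<open>U\<^sub>1\<close> is above \<open>1 / 2\<close>.\<close>
  have "\<not> U\<^sub>1 0 L \<le> U\<^sub>2 0 (L - (L - R))"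
    using L[of L 0] R[of R 0] by simp
  then obtain \<tau> where \<tau>: "\<And>t x. U\<^sub>1 t x = U\<^sub>2 t (x - \<tau>)"
    using critical_shift_coincides[OF pulsating_front_subsolution[OF U1] sup profile1 profile2]
    by blast
  have eq: "U\<^sub>1 = (\<lambda>t x. U\<^sub>2 t (x - \<tau>))" using \<tau> by (intro ext)
  have shifted: "parabolic_partials U\<^sub>1 (\<lambda>t x. partial_t U\<^sub>2 t (x - \<tau>))
      (\<lambda>t x. partial_xi U\<^sub>2 t (x - \<tau>)) (\<lambda>t x. partial_xi (partial_xi U\<^sub>2) t (x - \<tau>))"
    unfolding eq by (rule parabolic_partials_shift[OF pulsating_front_partials[OF U2]])
  have t: "partial_t U\<^sub>1 t x = partial_t U\<^sub>2 t (x - \<tau>)" for t x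
    using shifted by (auto simp: parabolic_partials_def partial_t_def intro: DERIV_imp_deriv)
  have x: "partial_xi U\<^sub>1 = (\<lambda>t x. partial_xi U\<^sub>2 t (x - \<tau>))"
    using shifted
    by (auto simp: parabolic_partials_def partial_xi_def[of U\<^sub>1] fun_eq_iff intro: DERIV_imp_deriv)
  have xx: "partial_xi (partial_xi U\<^sub>1) t x = partial_xi (partial_xi U\<^sub>2) t (x - \<tau>)" for t x
    unfolding x partial_xi_def[of "\<lambda>t x. partial_xi U\<^sub>2 t (x - \<tau>)"]
    using shifted by (auto simp: parabolic_partials_def intro: DERIV_imp_deriv)
  have "c\<^sub>1 * partial_xi U\<^sub>2 0 (0 - \<tau>) = c\<^sub>2 * partial_xi U\<^sub>2 0 (0 - \<tau>)"
    using pulsating_front_equation[OF U1, of 0 0] pulsating_front_equation[OF U2, of 0 "0 - \<tau>"]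
    unfolding t xx \<tau>[of 0 0] unfolding x by linarith
  then have "c\<^sub>1 = c\<^sub>2"
    using pulsating_front_strictly_decreasing[OF U2, of 0 "0 - \<tau>"] by simp
  then show thesis using \<tau> by (rule that)
qed

lemma pulsating_front_unique:
  assumes U1: "pulsating_front T f c\<^sub>1 U\<^sub>1" and U2: "pulsating_front T f c\<^sub>2 U\<^sub>2"
  shows "c\<^sub>1 = c\<^sub>2 \<and> (\<exists>\<tau>. \<forall>t x. U\<^sub>1 t x = U\<^sub>2 t (x - \<tau>))"
proof (cases "c\<^sub>2 \<le> c\<^sub>1")
  case True
  then show ?thesis using pulsating_front_unique_ordered_speeds[OF U1 U2] by metis
next
  case False
  then obtain \<tau> where "c\<^sub>2 = c\<^sub>1" and \<tau>: "\<And>t x. U\<^sub>2 t x = U\<^sub>1 t (x - \<tau>)"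
    using pulsating_front_unique_ordered_speeds[OF U2 U1] by auto
  have "U\<^sub>1 t x = U\<^sub>2 t (x - - \<tau>)" for t x using \<tau>[of t "x + \<tau>"] by simp
  with \<open>c\<^sub>2 = c\<^sub>1\<close> show ?thesis by metis
qed

end

theorem theorem1p1:
  fixes T :: real and f :: "real \<Rightarrow> real \<Rightarrow> real"
  assumes "T > 0"
    and "C_k_uniformly_on 1 UNIV {0..1} (\<lambda>u t. f t u)"
    and "C_k_uniformly_on 2 {0..1} UNIV (\<lambda>t u. f t u)"
    and "\<forall>t. \<forall>u\<in>{0..1}. f (t + T) u = f t u"
    and "\<forall>t. f t 0 = 0 \<and> f t 1 = 0"
    and "1 / T * integral {0..T} (\<lambda>s. partial_u f s 0) < 0"
    and "1 / T * integral {0..T} (\<lambda>s. partial_u f s 1) < 0"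
  shows "(\<forall>c\<^sub>1 U\<^sub>1 c\<^sub>2 U\<^sub>2. pulsating_front T f c\<^sub>1 U\<^sub>1 \<and> pulsating_front T f c\<^sub>2 U\<^sub>2 \<longrightarrow>
            c\<^sub>1 = c\<^sub>2 \<and> (\<exists>\<tau>. \<forall>t \<xi>. U\<^sub>1 t \<xi> = U\<^sub>2 t (\<xi> - \<tau>))) \<and>
         (\<forall>c U. pulsating_front T f c U \<longrightarrow> (\<forall>t \<xi>. partial_xi U t \<xi> < 0))"
proof -
  obtain D :: "nat \<Rightarrow> real \<Rightarrow> real \<Rightarrow> real" where
      D0: "\<forall>t\<in>UNIV. \<forall>u\<in>{0..1}. D 0 t u = f t u"
    and D_deriv: "\<forall>j<2. \<forall>t\<in>UNIV. \<forall>u\<in>{0..1}.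
          (D j t has_real_derivative D (Suc j) t u) (at u within {0..1})"
    and D_lim: "\<forall>j\<le>2. \<forall>u\<in>{0..1}.
          uniform_limit UNIV (\<lambda>v t. D j t v) (\<lambda>t. D j t u) (at u within {0..1})"
    using assms(3) unfolding C_k_uniformly_on_def by (elim exE conjE) (rule that)
  define fu where "fu = D (Suc 0)"
  have fu: "(f t has_real_derivative fu t u) (at u within {0..1})" if "u \<in> {0..1}" for t u
  proof (rule has_field_derivative_transform_within)
    show "(D 0 t has_real_derivative fu t u) (at u within {0..1})"
      using D_deriv that by (simp add: fu_def)
    show "(0::real) < 1" by simp
  qed (use D0 that in auto)
  have partial_u: "partial_u f t u = fu t u" if "u \<in> {0..1}" for t u
    unfolding partial_u_def using fu[OF that] that
    by (intro vector_derivative_within_closed_interval)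
      (auto simp: has_real_derivative_iff_has_vector_derivative)
  have cont: "continuous_on UNIV (\<lambda>t. f t u)" if u: "u \<in> {0..1}" for u
  proof -
    obtain E :: "nat \<Rightarrow> real \<Rightarrow> real \<Rightarrow> real" where
        E0: "\<forall>u\<in>{0..1}. \<forall>t\<in>UNIV. E 0 u t = f t u"
      and E: "\<forall>j<1. \<forall>u\<in>{0..1}. \<forall>t\<in>UNIV. (E j u has_real_derivative E (Suc j) u t) (at t)"
      using assms(2) unfolding C_k_uniformly_on_def by (elim exE conjE) (rule that)
    have "E 0 u = (\<lambda>t. f t u)" using E0 u by auto
    moreover have "continuous_on UNIV (E 0 u)"
      using E u by (intro DERIV_continuous_on[of _ _ "E 1 u"]) simp
    ultimately show ?thesis by simp
  qed
  have mean: "integral {0..T} (\<lambda>s. fu s u) < 0"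
    if "1 / T * integral {0..T} (\<lambda>s. partial_u f s u) < 0" "u \<in> {0..1}" for u
    using that(1) \<open>T > 0\<close> partial_u[OF that(2)] by (simp add: divide_less_0_iff)
  interpret bistable_reaction T f fu
  proof
    show "0 < T" by fact
    show "f (t + T) u = f t u" if "u \<in> {0..1}" for t u using assms(4) that by blast
    show "uniform_limit UNIV (\<lambda>v t. fu t v) (\<lambda>t. fu t u) (at u within {0..1})"
      if "u \<in> {0..1}" for u
      using D_lim that by (simp add: fu_def)
    show "integral {0..T} (\<lambda>s. fu s 0) < 0" "integral {0..T} (\<lambda>s. fu s 1) < 0"
      using mean assms(6,7) by auto
  qed (use fu cont in auto)
  show ?thesis
    using pulsating_front_unique pulsating_front_strictly_decreasing by blast
qed

end
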